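(* For an integer $k\geq 1$ and an integer $n \geq 0$, let $a_k(n)$ denote the number of partitions of $n$ in which each even part comes in only one color while each odd part may be colored with one of $k$ colors; equivalently, $$\sum_{n=0}^\infty a_k(n)q^n = \frac{(q^2;q^2)_\infty^{k-1}}{(q;q)_\infty^{k}}.$$ Then for all $n\geq 0$, \begin{align*} a_{1}(7n+5) & \equiv 0 \pmod{7},\\ a_{3}(7n+2) & \equiv 0 \pmod{7},\\ a_{4}(7n+4) & \equiv 0 \pmod{7},\\ a_{5}(7n+6) & \equiv 0 \pmod{7},\\ a_{7}(7n+3) & \equiv 0 \pmod{7}. \end{align*}
   Context: Here $(A;q)_\infty = \prod_{i\geq 0}(1-Aq^i)$ is the $q$-Pochhammer symbol. In a $k$-colored partition, parts of the same size but different colors are distinguished, and partitions are unordered multisets of colored parts (e.g. $a_3(3)=16$). *)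

theory Defs
  imports
    "HOL-Analysis.Analysis"
    "HOL-Number_Theory.Cong"
    "HOL-Library.Multiset"
begin

text \<open>
  A coloured part is a pair of a size and a colour; colours are numbered from \<open>0\<close>.
\<close>

definition num_colors :: "nat \<Rightarrow> nat \<Rightarrow> nat" where
  "num_colors k s = (if even s then 1 else k)"

definition colored_partitions :: "nat \<Rightarrow> nat \<Rightarrow> (nat \<times> nat) multiset set" where
  "colored_partitions k n =
     {M. (\<forall>(s, c) \<in># M. s > 0 \<and> c < num_colors k s) \<and> (\<Sum>(s, c) \<in># M. s) = n}"

definition a_colored :: "nat \<Rightarrow> nat \<Rightarrow> nat" where
  "a_colored k n = card (colored_partitions k n)"

definition q_Pochhammer_inf :: "'a \<Rightarrow> 'a \<Rightarrow> 'a :: {t2_space, comm_ring_1}" where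
  "q_Pochhammer_inf A q = (\<Prod>i. 1 - A * q ^ i)"

definition wmsets :: "('b \<Rightarrow> nat) \<Rightarrow> 'b set \<Rightarrow> nat \<Rightarrow> 'b multiset set" where
  "wmsets w T n = {M. set_mset M \<subseteq> T \<and> (\<Sum>x\<in>#M. w x) = n}"

lemma finite_wmsets:
  assumes "finite T" "\<And>x. x \<in> T \<Longrightarrow> w x > 0"
  shows "finite (wmsets w T n)"
proof (rule finite_subset)
  have sz: "size M \<le> (\<Sum>x\<in>#M. w x)" if "set_mset M \<subseteq> T" for M
    using that
  proof (induction M)
    case (add x M)
    have "w x > 0" "set_mset M \<subseteq> T" using add.prems assms(2) by simp_all
    with add.IH show ?case by simp
  qed simp
  show "wmsets w T n \<subseteq> (\<Union>m\<le>n. multisets_of_size T m)"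
    using sz by (auto simp: wmsets_def multisets_of_size_def)
  show "finite (\<Union>m\<le>n. multisets_of_size T m)"
    using assms(1) by (intro finite_UN_I finite_multisets_of_size) simp_all
qed

lemma wmsets_empty: "wmsets w {} n = (if n = 0 then {{#}} else {})"
  by (auto simp: wmsets_def)

lemma card_wmsets_insert:
  assumes "finite T" "\<And>x. x \<in> T \<Longrightarrow> w x > 0" "t \<notin> T" "w t > 0"
  shows "card (wmsets w (insert t T) n) =
           card (wmsets w T n) + (if w t \<le> n then card (wmsets w (insert t T) (n - w t)) else 0)"
proof -
  define B where "B = {M \<in> wmsets w (insert t T) n. t \<in># M}"
  have "w x > 0" if "x \<in> insert t T" for x
    using that assms(2,4) by blast
  then have fin: "finite (wmsets w (insert t T) n)"
    using finite_wmsets[of "insert t T" w n] assms(1) by blast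
  have split: "wmsets w (insert t T) n = wmsets w T n \<union> B"
    unfolding wmsets_def B_def by blast
  have "card (wmsets w T n \<union> B) = card (wmsets w T n) + card B"
  proof (rule card_Un_disjoint)
    show "finite (wmsets w T n)" "finite B"
      using fin unfolding split by simp_all
    show "wmsets w T n \<inter> B = {}"
      using assms(3) unfolding wmsets_def B_def by blast
  qed
  moreover have "card B = (if w t \<le> n then card (wmsets w (insert t T) (n - w t)) else 0)"
  proof (cases "w t \<le> n")
    case True
    have "B = add_mset t ` wmsets w (insert t T) (n - w t)"
    proof (intro equalityI subsetI)
      fix M assume M: "M \<in> B"
      then have "t \<in># M" by (simp add: B_def)
      then obtain M' where M': "M = add_mset t M'"
        by (meson multi_member_split)
      with M have "M' \<in> wmsets w (insert t T) (n - w t)"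
        by (simp add: B_def wmsets_def) linarith
      with M' show "M \<in> add_mset t ` wmsets w (insert t T) (n - w t)" by blast
    next
      fix M assume "M \<in> add_mset t ` wmsets w (insert t T) (n - w t)"
      then obtain M' where "M = add_mset t M'" "M' \<in> wmsets w (insert t T) (n - w t)"
        by blast
      with True show "M \<in> B" by (simp add: B_def wmsets_def)
    qed
    then show ?thesis
      using True by (simp add: card_image inj_on_def)
  next
    case False
    have "B = {}"
    proof (rule ccontr)
      assume "B \<noteq> {}"
      then obtain M where M: "M \<in> wmsets w (insert t T) n" "t \<in># M"
        unfolding B_def by blast
      then obtain M' where "M = add_mset t M'" by (meson multi_member_split)
      with M False show False by (simp add: wmsets_def)
    qed
    then show ?thesis using False by simp
  qed
  ultimately show ?thesis unfolding split by simp
qed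

lemma wmsets_gf:
  assumes "finite T" "\<And>x. x \<in> T \<Longrightarrow> w x > 0"
  shows "Abs_fps (\<lambda>n. of_nat (card (wmsets w T n))) * (\<Prod>t\<in>T. 1 - fps_X ^ w t) =
           (1 :: 'a :: field fps)"
  using assms
proof (induction T rule: finite_induct)
  case empty
  then show ?case
    by (intro fps_ext) (auto simp: wmsets_empty)
next
  case (insert t T)
  let ?F = "\<lambda>T. Abs_fps (\<lambda>n. of_nat (card (wmsets w T n))) :: 'a fps"
  have "?F (insert t T) * (1 - fps_X ^ w t) = ?F T"
  proof (rule fps_ext)
    fix n
    show "fps_nth (?F (insert t T) * (1 - fps_X ^ w t)) n = fps_nth (?F T) n"
      using card_wmsets_insert[of T w t n] insert
      by (auto simp: right_diff_distrib fps_X_power_mult_right_nth)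
  qed
  then have "?F (insert t T) * (\<Prod>t\<in>insert t T. 1 - fps_X ^ w t) = ?F T * (\<Prod>t\<in>T. 1 - fps_X ^ w t)"
    using insert by (simp add: mult.assoc [symmetric])
  with insert show ?case by simp
qed

lemma tendsto_mult_fps:
  fixes f g :: "'b \<Rightarrow> 'a :: comm_ring_1 fps"
  assumes "(f \<longlongrightarrow> F) H" "(g \<longlongrightarrow> G) H"
  shows "((\<lambda>x. f x * g x) \<longlongrightarrow> F * G) H"
proof (rule tendsto_fpsI)
  fix n
  have "eventually (\<lambda>x. \<forall>i\<in>{0..n}. fps_nth (f x) i = fps_nth F i) H"
       "eventually (\<lambda>x. \<forall>i\<in>{0..n}. fps_nth (g x) i = fps_nth G i) H"
    using assms by (auto simp: tendsto_fps_iff eventually_ball_finite_distrib)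
  then show "eventually (\<lambda>x. fps_nth (f x * g x) n = fps_nth (F * G) n) H"
    by eventually_elim (auto simp: fps_mult_nth intro!: sum.cong)
qed

lemma tendsto_power_fps:
  fixes f :: "'b \<Rightarrow> 'a :: comm_ring_1 fps"
  assumes "(f \<longlongrightarrow> F) H"
  shows "((\<lambda>x. f x ^ m) \<longlongrightarrow> F ^ m) H"
  by (induction m) (auto intro: tendsto_mult_fps assms)

lemma q_Pochhammer_inf_fps:
  fixes m :: nat
  assumes "m > 0"
  defines "P \<equiv> q_Pochhammer_inf (fps_X ^ m) (fps_X ^ m) :: 'a :: field fps"
  shows "(\<lambda>n. \<Prod>i<n. 1 - fps_X ^ m * (fps_X ^ m) ^ i) \<longlonglongrightarrow> P" "fps_nth P 0 = 1"
proof -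
  define f where "f = (\<lambda>i. 1 - fps_X ^ m * (fps_X ^ m) ^ i :: 'a fps)"
  define L where "L = Abs_fps (\<lambda>j. fps_nth (\<Prod>i<j. f i) j)"
  have f: "f i = 1 - fps_X ^ (m * Suc i)" for i
    by (simp only: f_def power_mult power_Suc)
  have stable: "fps_nth (\<Prod>i<n. f i) j = fps_nth (\<Prod>i<j. f i) j" if "j \<le> n" for n j
    using that
  proof (induction n rule: dec_induct)
    case (step n)
    have "1 * Suc n \<le> m * Suc n" using \<open>m > 0\<close> by (intro mult_le_mono1) simp
    then have j: "j < m * Suc n"
      using less_le_trans[of j "Suc n" "m * Suc n"] \<open>j \<le> n\<close>
      by (simp only: mult_1)
    have "fps_nth (\<Prod>i<Suc n. f i) j = fps_nth ((\<Prod>i<n. f i) * (1 - fps_X ^ (m * Suc n))) j"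
      by (simp only: prod.lessThan_Suc f)
    also have "\<dots> = fps_nth (\<Prod>i<n. f i) j"
      using j by (simp only: right_diff_distrib fps_sub_nth fps_X_power_mult_right_nth) simp
    finally show ?case using step.IH by simp
  qed (rule refl)
  have lim: "(\<lambda>n. \<Prod>i<n. f i) \<longlonglongrightarrow> L"
  proof (rule tendsto_fpsI)
    fix j show "eventually (\<lambda>n. fps_nth (\<Prod>i<n. f i) j = fps_nth L j) sequentially"
      using eventually_ge_at_top[of j]
      unfolding L_def fps_nth_Abs_fps by eventually_elim (rule stable)
  qed
  have L0: "fps_nth L 0 = 1" by (simp add: L_def)
  then have "L \<noteq> 0" by (metis fps_zero_nth zero_neq_one)
  moreover from lim have "(\<lambda>n. \<Prod>i\<le>n. f i) \<longlonglongrightarrow> L"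
    by (simp only: LIMSEQ_lessThan_iff_atMost)
  ultimately have "f has_prod L"
    by (simp add: has_prod_def raw_has_prod_def)
  then have "L = P"
    unfolding P_def q_Pochhammer_inf_def f_def [symmetric] by (rule has_prod_unique)
  then show "(\<lambda>n. \<Prod>i<n. 1 - fps_X ^ m * (fps_X ^ m) ^ i) \<longlonglongrightarrow> P" "fps_nth P 0 = 1"
    using lim L0 unfolding f_def by blast+
qed

definition parts_upto :: "nat \<Rightarrow> nat \<Rightarrow> (nat \<times> nat) set" where
  "parts_upto k N = (SIGMA s:{0<..N}. {..<num_colors k s})"

lemma colored_partitions_eq_wmsets:
  assumes "n \<le> N"
  shows "colored_partitions k n = wmsets fst (parts_upto k N) n"
proof -
  have "s \<le> (\<Sum>(s, c) \<in># M. s)" if sc: "(s, c) \<in># M" for s c and M :: "(nat \<times> nat) multiset"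
  proof -
    obtain M' where "M = add_mset (s, c) M'"
      using sc by (meson multi_member_split)
    then show ?thesis by simp
  qed
  then show ?thesis using assms
    unfolding colored_partitions_def wmsets_def parts_upto_def
    by (fastforce simp: case_prod_unfold)
qed

lemma finite_colored_partitions: "finite (colored_partitions k n)"
  unfolding colored_partitions_eq_wmsets[OF order_refl]
  by (rule finite_wmsets) (auto simp: parts_upto_def)

theorem a_colored_generating_function:
  assumes "k \<ge> 1"
  shows "Abs_fps (\<lambda>n. of_nat (a_colored k n)) =
           q_Pochhammer_inf (fps_X ^ 2) (fps_X ^ 2) ^ (k - 1) /
           (q_Pochhammer_inf fps_X fps_X ^ k :: 'a :: field fps)"
proof -
  let ?A = "Abs_fps (\<lambda>n. of_nat (a_colored k n)) :: 'a fps"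
  define P where "P = (\<lambda>m n. \<Prod>i<n. 1 - fps_X ^ m * (fps_X ^ m) ^ i :: 'a fps)"
  define Q where "Q = (\<lambda>m. q_Pochhammer_inf (fps_X ^ m) (fps_X ^ m) :: 'a fps)"
  define B where "B = (\<lambda>N. Abs_fps (\<lambda>n. of_nat (card (wmsets fst (parts_upto k N) n))) :: 'a fps)"
  define R where "R = (\<lambda>N. \<Prod>s\<in>{0<..N}. (1 - fps_X ^ s) ^ num_colors k s :: 'a fps)"
  have limP: "(\<lambda>n. P m n) \<longlonglongrightarrow> Q m" "fps_nth (Q m) 0 = 1" if "m > 0" for m
    using q_Pochhammer_inf_fps[OF that] by (auto simp: P_def Q_def)
  have limB: "B \<longlonglongrightarrow> ?A"
  proof (rule tendsto_fpsI)
    fix n show "eventually (\<lambda>N. fps_nth (B N) n = fps_nth ?A n) sequentially"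
      using eventually_ge_at_top[of n]
      by eventually_elim (simp add: B_def a_colored_def colored_partitions_eq_wmsets)
  qed
  have BR: "B N * R N = 1" for N
  proof -
    have "R N = (\<Prod>t\<in>parts_upto k N. 1 - fps_X ^ fst t)"
      unfolding parts_upto_def R_def
      by (subst prod.Sigma [symmetric, where g = "\<lambda>s _. 1 - fps_X ^ s", simplified case_prod_unfold]) auto
    then show ?thesis
      unfolding B_def by (simp only:) (rule wmsets_gf, auto simp: parts_upto_def)
  qed
  have RP: "R (2 * n) * P 2 n ^ (k - 1) = P 1 (2 * n) ^ k" for n
  proof (induction n)
    case 0
    then show ?case by (simp add: R_def P_def)
  next
    case (Suc n)
    have S: "{0<..Suc N} = insert (Suc N) {0<..N}" for N by auto
    have R: "R (Suc N) = R N * (1 - fps_X ^ Suc N) ^ num_colors k (Suc N)" for N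
      unfolding R_def S by (simp add: mult.commute)
    have P1: "P 1 (Suc N) = P 1 N * (1 - fps_X ^ Suc N)" for N
      by (simp add: P_def)
    have P2: "P 2 (Suc n) = P 2 n * (1 - fps_X ^ Suc (Suc (2 * n)))"
      by (simp add: P_def power2_eq_square power_mult_distrib mult_ac power_mult)
    have k: "z ^ k = z * z ^ (k - 1)" for z :: "'a fps"
      using assms by (cases k) auto
    have "R (2 * Suc n) * P 2 (Suc n) ^ (k - 1) =
            (R (2 * n) * P 2 n ^ (k - 1)) * (1 - fps_X ^ Suc (2 * n)) ^ k *
            ((1 - fps_X ^ Suc (Suc (2 * n))) * (1 - fps_X ^ Suc (Suc (2 * n))) ^ (k - 1))"
      by (simp add: R P2 num_colors_def power_mult_distrib mult_ac del: power_Suc)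
    also have "\<dots> = P 1 (2 * Suc n) ^ k"
      unfolding Suc.IH k[symmetric] by (simp add: P1 [unfolded One_nat_def] power_mult_distrib del: power_Suc)
    finally show ?case .
  qed
  have eq: "B (2 * n) * P 1 (2 * n) ^ k = P 2 n ^ (k - 1)" for n
    unfolding RP[symmetric] by (simp add: BR flip: mult.assoc)
  have dbl: "filterlim (\<lambda>n::nat. 2 * n) sequentially sequentially"
    by (rule filterlim_subseq) (auto simp: strict_mono_def)
  have "(\<lambda>n. B (2 * n) * P 1 (2 * n) ^ k) \<longlonglongrightarrow> ?A * Q 1 ^ k"
    by (intro tendsto_mult_fps tendsto_power_fps
          filterlim_compose[OF limB dbl] filterlim_compose[OF limP(1) dbl]) auto
  moreover have "(\<lambda>n. B (2 * n) * P 1 (2 * n) ^ k) \<longlonglongrightarrow> Q 2 ^ (k - 1)"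
    unfolding eq by (intro tendsto_power_fps limP) auto
  ultimately have "?A * Q 1 ^ k = Q 2 ^ (k - 1)"
    by (rule LIMSEQ_unique)
  moreover have "Q 1 \<noteq> 0"
    using limP(2)[of 1] by auto
  then have "?A * Q 1 ^ k / Q 1 ^ k = ?A"
    by (intro nonzero_mult_div_cancel_right) simp
  ultimately have "?A = Q 2 ^ (k - 1) / Q 1 ^ k"
    by simp
  then show ?thesis by (simp add: Q_def)
qed

end

theory Submission
  imports
    Defs
    "HOL-Computational_Algebra.Formal_Laurent_Series"
begin

text \<open>
  Write \<open>f\<^sub>m = (q\<^sup>m;q\<^sup>m)\<^sub>\<infinity>\<close>. The coefficients of \<open>f\<^sub>1\<^sup>7\<close> outside the multiples of 7 vanish modulo 7,
  because its derivative is divisible by 7. Multiplying the generating function by \<open>f\<^sub>1\<^sup>7\<close> therefore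
  reduces the congruences to the residue class in question of
  \<open>f\<^sub>1\<^sup>6\<close>, \<open>f\<^sub>1\<^sup>4 f\<^sub>2\<^sup>2\<close>, \<open>f\<^sub>1\<^sup>3 f\<^sub>2\<^sup>3\<close>, \<open>f\<^sub>1\<^sup>2 f\<^sub>2\<^sup>4\<close> and \<open>f\<^sub>2\<^sup>6\<close>.
  Each of these is a product of two theta series whose coefficients are linear in the summation index:
  Jacobi's \<open>f\<^sub>1\<^sup>3 = \<Sum>\<^sub>j\<^sub>\<ge>\<^sub>0 (-1)\<^sup>j (2j+1) q\<^bsup>j(j+1)/2\<^esup>\<close>, and with
  \<open>S(q) = f\<^sub>1\<^sup>5/f\<^sub>2\<^sup>2 = \<Sum>\<^sub>m (6m+1) q\<^bsup>m(3m+1)/2\<^esup>\<close> and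
  \<open>T(q) = f\<^sub>2\<^sup>5/f\<^sub>1\<^sup>2 = \<Sum>\<^sub>m (-1)\<^sup>m (3m+1) q\<^bsup>m(3m+2)\<^esup>\<close> (sums over all integers) one has
  \<open>f\<^sub>1\<^sup>2 f\<^sub>2\<^sup>4 = T(-q) S(q\<^sup>2)\<close> and \<open>f\<^sub>2\<^sup>4 f\<^sub>4\<^sup>2 = T(q) T(-q)\<close>.
  Completing squares in the exponents turns the residue class into \<open>u\<^sup>2 + v\<^sup>2 \<equiv> 0\<close> or \<open>u\<^sup>2 + 2v\<^sup>2 \<equiv> 0\<close>
  modulo 7, where \<open>u\<close> and \<open>v\<close> are, up to constants, the two linear coefficients. Both forms are
  anisotropic modulo 7, so the coefficients vanish.
\<close>

section \<open>A finite form of the Jacobi triple product\<close>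

text \<open>\<open>j * (j - 1)\<close> is even and nonnegative for every integer \<open>j\<close>,
  so neither \<open>div\<close> nor \<open>nat\<close> distorts the value j(j-1)/2.\<close>

definition tri :: "int \<Rightarrow> nat" where
  "tri j = nat (j * (j - 1) div 2)"

lemma two_tri: "2 * int (tri j) = j * (j - 1)"
proof -
  have "even (j * (j - 1))" by simp
  moreover have "j * (j - 1) \<ge> 0"
    by (cases "j \<ge> 1") (auto intro: mult_nonneg_nonneg mult_nonpos_nonpos)
  ultimately show ?thesis unfolding tri_def by simp
qed

lemma tri_step: "int (tri (j + 1)) = int (tri j) + j"
  using two_tri[of j] two_tri[of "j + 1"] by (simp add: algebra_simps)

lemma tri_reflect: "tri (1 - j) = tri j"
  using two_tri[of j] two_tri[of "1 - j"] by (simp add: algebra_simps)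

text \<open>From (|j|-1)(|j|-2) >= 0, a product of consecutive integers. Such linear bounds make the
  sets of indices with bounded exponent finite.\<close>

lemma abs_le_tri: "\<bar>j\<bar> \<le> int (tri j) + 1"
proof -
  have "0 \<le> (\<bar>j\<bar> - 1) * (\<bar>j\<bar> - 2)"
    by (cases "\<bar>j\<bar> \<ge> 2") (auto intro: mult_nonneg_nonneg mult_nonpos_nonpos)
  then have "2 * \<bar>j\<bar> \<le> j * (j - 1) + 2"
    by (cases "j \<ge> 0") (auto simp: algebra_simps)
  then show ?thesis using two_tri[of j] by linarith
qed

lemma abs_le_tri_Suc: "\<bar>j\<bar> \<le> int (tri (j + 1)) + 1"
  using abs_le_tri[of "- j"] tri_reflect[of "- j"] by (simp add: add.commute)

text \<open>Gaussian binomial coefficients, given by a q-Pascal rule because quotients of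
  q-factorials make no sense in a general commutative ring.\<close>

fun qbin :: "'a::comm_ring_1 \<Rightarrow> nat \<Rightarrow> nat \<Rightarrow> 'a" where
  "qbin q n 0 = 1"
| "qbin q 0 (Suc k) = 0"
| "qbin q (Suc n) (Suc k) = qbin q n k + q ^ Suc k * qbin q n (Suc k)"

lemma qbin_eq_0: "n < k \<Longrightarrow> qbin q n k = 0"
proof (induction n arbitrary: k)
  case 0
  then show ?case by (cases k) auto
next
  case (Suc n)
  then show ?case by (cases k) auto
qed

lemma qbin_diag: "qbin q n n = 1"
  by (induction n) (auto simp: qbin_eq_0)

text \<open>The other q-Pascal rule. Both are needed: this one extends a finite theta sum at its
  upper end, the defining one at its lower end.\<close>

lemma qbin_Suc_Suc':
  "k \<le> n \<Longrightarrow> qbin q (Suc n) (Suc k) = q ^ (n - k) * qbin q n k + qbin q n (Suc k)"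
proof (induction n arbitrary: k)
  case 0
  then show ?case by simp
next
  case (Suc n)
  show ?case
  proof (cases "k = Suc n")
    case True
    then show ?thesis by (simp add: qbin_diag qbin_eq_0)
  next
    case False
    with Suc.prems have kn: "k \<le> n" by simp
    note IH = Suc.IH[OF kn]
    show ?thesis
    proof (cases k)
      case 0
      have "qbin q (Suc (Suc n)) (Suc 0) = 1 + q * qbin q (Suc n) (Suc 0)" by simp
      also have "\<dots> = 1 + q * (q ^ n + qbin q n (Suc 0))" using IH 0 by simp
      finally show ?thesis using 0 by (simp add: algebra_simps)
    next
      case (Suc l)
      define d where "d = n - k"
      have d: "n - k = d" "n - l = Suc d" "Suc n - k = Suc d" "n = d + Suc l"
        using kn Suc by (auto simp: d_def)
      have a: "qbin q (Suc n) (Suc l) = q ^ (n - l) * qbin q n l + qbin q n (Suc l)"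
        using Suc.IH[of l] kn Suc by simp
      have b: "qbin q (Suc n) (Suc l) = qbin q n l + q ^ Suc l * qbin q n (Suc l)" by simp
      have "qbin q (Suc (Suc n)) (Suc k) = qbin q (Suc n) k + q ^ Suc k * qbin q (Suc n) (Suc k)"
        by (simp only: qbin.simps)
      also have "\<dots> = q ^ Suc d * qbin q n l + qbin q n (Suc l)
                 + q ^ Suc k * (q ^ d * qbin q n k + qbin q n (Suc k))"
        using a IH by (simp only: d(1,2) Suc [symmetric])
      also have "\<dots> = q ^ Suc d * (qbin q n l + q ^ Suc l * qbin q n (Suc l))
                 + (qbin q n k + q ^ Suc k * qbin q n (Suc k))"
        unfolding Suc by (simp only: power_Suc) (simp add: algebra_simps)
      also have "\<dots> = q ^ (Suc n - k) * qbin q (Suc n) k + qbin q (Suc n) (Suc k)"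
        unfolding d(3) by (simp only: Suc qbin.simps)
      finally show ?thesis .
    qed
  qed
qed

text \<open>The quotient formula with the q-factorials \<open>F\<close> multiplied out. Induction on
  the row, from 1 - q^(k+m) = (1 - q^k) + q^k (1 - q^m).\<close>

lemma qbin_factorial:
  fixes q :: "'a::comm_ring_1"
  defines "F \<equiv> \<lambda>n. \<Prod>i<n. 1 - q ^ Suc i"
  shows "qbin q (k + m) k * F k * F m = F (k + m)"
proof (induction "k + m" arbitrary: k m)
  case 0
  then show ?case by (simp add: F_def)
next
  case (Suc n)
  have F: "F (Suc j) = F j * (1 - q ^ Suc j)" for j by (simp add: F_def)
  have F0: "F 0 = 1" by (simp add: F_def)
  show ?case
  proof (cases k)
    case 0
    then show ?thesis by (simp add: F0)
  next
    case k: (Suc k')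
    show ?thesis
    proof (cases m)
      case 0
      then show ?thesis by (simp add: F0 qbin_diag)
    next
      case m: (Suc m')
      have 1: "qbin q n k' * F k' * F m = F n"
        using Suc.hyps(1)[of k' m] Suc.hyps(2) k by simp
      have 2: "qbin q n k * F k * F m' = F n"
        using Suc.hyps(1)[of k m'] Suc.hyps(2) m by simp
      have n: "k + m = Suc n" "Suc n = Suc k' + Suc m'" using Suc.hyps(2) k m by simp_all
      have "qbin q (k + m) k * F k * F m =
              (qbin q n k' + q ^ Suc k' * qbin q n k) * F k * F m"
        unfolding n(1) by (simp only: k qbin.simps)
      also have "\<dots> = (qbin q n k' * F k' * F m) * (1 - q ^ Suc k')
              + q ^ Suc k' * (1 - q ^ Suc m') * (qbin q n k * F k * F m')"
        unfolding k m F by (simp only: algebra_simps)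
      also have "\<dots> = F n * (1 - q ^ (Suc k' + Suc m'))"
        unfolding 1 2 power_add by (simp only: ring_distribs mult_ac) simp
      also have "\<dots> = F (k + m)" by (simp only: n(1) F n(2) [symmetric])
      finally show ?thesis .
    qed
  qed
qed

section \<open>Finite theta sums and their product form\<close>

context
  fixes a b :: "'a::comm_ring_1"
begin

text \<open>The general term of Ramanujan's theta function f(a, b); the base q is
  \<open>a * b\<close>.\<close>

definition jterm :: "int \<Rightarrow> 'a" where
  "jterm j = a ^ tri (j + 1) * b ^ tri j"

text \<open>The window -n <= j <= m of the theta series. The weight \<open>w\<close> is left free so
  that one recursion serves both the triple product and its derivative.\<close>

definition jsum :: "(int \<Rightarrow> 'a) \<Rightarrow> nat \<Rightarrow> nat \<Rightarrow> 'a" where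
  "jsum w m n = (\<Sum>k\<le>m + n. w (int k - int n) * qbin (a * b) (m + n) k * jterm (int k - int n))"

text \<open>The ratio of consecutive terms is a (ab)^j; as j may be negative, it is stated with the
  natural exponent p = m - j.\<close>

lemma jterm_up:
  assumes "int p = int m - j"
  shows "(a * b) ^ p * jterm (j + 1) = a * (a * b) ^ m * jterm j"
proof -
  have "p + tri (j + 1 + 1) = Suc (m + tri (j + 1))" "p + tri (j + 1) = m + tri j"
    using assms tri_step[of j] tri_step[of "j + 1"] by linarith+
  then have "a ^ (p + tri (j + 1 + 1)) * b ^ (p + tri (j + 1)) = a ^ Suc (m + tri (j + 1)) * b ^ (m + tri j)"
    by simp
  then show ?thesis
    by (simp add: jterm_def power_mult_distrib power_add mult_ac)
qed

lemma jterm_down: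
  assumes "int p = int n + j"
  shows "(a * b) ^ p * jterm (j - 1) = b * (a * b) ^ n * jterm j"
proof -
  have "p + tri j = n + tri (j + 1)" "p + tri (j - 1) = Suc (n + tri j)"
    using assms tri_step[of j] tri_step[of "j - 1"] by simp_all
  then have "a ^ (p + tri j) * b ^ (p + tri (j - 1)) = a ^ (n + tri (j + 1)) * b ^ Suc (n + tri j)"
    by simp
  then show ?thesis
    by (simp add: jterm_def power_mult_distrib power_add mult_ac)
qed

text \<open>\<open>qbin_Suc_Suc'\<close> splits row m+n+1. In the part carrying a power of q the
  index moves up by one, which shifts the weight and yields the factor of
  \<open>jterm_up\<close>.\<close>

lemma jsum_Suc_left:
  "jsum w (Suc m) n = jsum w m n + a * (a * b) ^ m * jsum (\<lambda>j. w (j + 1)) m n"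
proof -
  define N where "N = m + n"
  define q where "q = a * b"
  define g where "g = (\<lambda>k. w (int k - int n) * jterm (int k - int n))"
  have "jsum w (Suc m) n = (\<Sum>k\<le>Suc N. qbin q (Suc N) k * g k)"
    unfolding jsum_def N_def q_def g_def by (simp add: mult_ac)
  also have "\<dots> = g 0 + (\<Sum>k\<le>N. qbin q (Suc N) (Suc k) * g (Suc k))"
    by (subst sum.atMost_Suc_shift) simp
  also have "(\<Sum>k\<le>N. qbin q (Suc N) (Suc k) * g (Suc k)) =
      (\<Sum>k\<le>N. qbin q N (Suc k) * g (Suc k)) + (\<Sum>k\<le>N. q ^ (N - k) * qbin q N k * g (Suc k))"
    by (subst sum.distrib [symmetric], intro sum.cong refl) (auto simp: qbin_Suc_Suc' algebra_simps simp del: qbin.simps)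
  also have "g 0 + (\<dots>) = (\<Sum>k\<le>Suc N. qbin q N k * g k) + (\<Sum>k\<le>N. q ^ (N - k) * qbin q N k * g (Suc k))"
    by (simp add: sum.atMost_Suc_shift[of "\<lambda>k. qbin q N k * g k" N] add_ac del: sum.atMost_Suc)
  also have "(\<Sum>k\<le>Suc N. qbin q N k * g k) = jsum w m n"
    unfolding jsum_def N_def q_def g_def by (simp add: qbin_eq_0 mult_ac)
  also have "(\<Sum>k\<le>N. q ^ (N - k) * qbin q N k * g (Suc k)) = a * q ^ m * jsum (\<lambda>j. w (j + 1)) m n"
    unfolding jsum_def sum_distrib_left
  proof (intro sum.cong)
    fix k assume "k \<in> {..m + n}"
    then have "int (N - k) = int m - (int k - int n)" unfolding N_def by auto
    from jterm_up[OF this]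
    have *: "q ^ (N - k) * jterm (int k - int n + 1) = a * q ^ m * jterm (int k - int n)"
      by (simp add: q_def)
    have s: "int (Suc k) - int n = int k - int n + 1" by simp
    have "q ^ (N - k) * qbin q N k * g (Suc k) =
        w (int k - int n + 1) * qbin q N k * (q ^ (N - k) * jterm (int k - int n + 1))"
      by (simp only: g_def s mult_ac)
    also have "\<dots> = a * q ^ m * (w (int k - int n + 1) * qbin (a * b) (m + n) k * jterm (int k - int n))"
      unfolding * by (simp only: N_def q_def mult_ac)
    finally show "q ^ (N - k) * qbin q N k * g (Suc k) =
       a * q ^ m * (w (int k - int n + 1) * qbin (a * b) (m + n) k * jterm (int k - int n))" .
  qed (simp add: N_def)
  finally show ?thesis by (simp add: q_def)
qed

text \<open>The mirror image, with the defining q-Pascal rule and \<open>jterm_down\<close>.\<close>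

lemma jsum_Suc_right:
  "jsum w m (Suc n) = jsum w m n + b * (a * b) ^ n * jsum (\<lambda>j. w (j - 1)) m n"
proof -
  define N where "N = m + n"
  define q where "q = a * b"
  define g where "g = (\<lambda>k. w (int k - int n - 1) * jterm (int k - int n - 1))"
  have s: "int k - int (Suc n) = int k - int n - 1" for k by simp
  have "jsum w m (Suc n) = (\<Sum>k\<le>Suc N. qbin q (Suc N) k * g k)"
    unfolding jsum_def N_def q_def g_def s by (simp add: mult_ac)
  also have "\<dots> = g 0 + (\<Sum>k\<le>N. qbin q (Suc N) (Suc k) * g (Suc k))"
    by (subst sum.atMost_Suc_shift) simp
  also have "(\<Sum>k\<le>N. qbin q (Suc N) (Suc k) * g (Suc k)) =
      (\<Sum>k\<le>N. q ^ Suc k * qbin q N (Suc k) * g (Suc k)) + (\<Sum>k\<le>N. qbin q N k * g (Suc k))"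
    by (subst sum.distrib [symmetric], intro sum.cong refl) (auto simp: algebra_simps)
  also have "g 0 + (\<dots>) = (\<Sum>k\<le>Suc N. q ^ k * qbin q N k * g k) + (\<Sum>k\<le>N. qbin q N k * g (Suc k))"
    by (simp add: sum.atMost_Suc_shift[of "\<lambda>k. q ^ k * qbin q N k * g k" N] add_ac del: sum.atMost_Suc)
  also have "(\<Sum>k\<le>N. qbin q N k * g (Suc k)) = jsum w m n"
    unfolding jsum_def N_def q_def g_def by (simp add: mult_ac)
  also have "(\<Sum>k\<le>Suc N. q ^ k * qbin q N k * g k) = (\<Sum>k\<le>N. q ^ k * qbin q N k * g k)"
    by (simp add: qbin_eq_0)
  also have "\<dots> = b * q ^ n * jsum (\<lambda>j. w (j - 1)) m n"
    unfolding jsum_def sum_distrib_left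
  proof (intro sum.cong)
    fix k
    have "int k = int n + (int k - int n)" by simp
    from jterm_down[OF this]
    have *: "q ^ k * jterm (int k - int n - 1) = b * q ^ n * jterm (int k - int n)"
      by (simp add: q_def)
    have "q ^ k * qbin q N k * g k =
        w (int k - int n - 1) * qbin q N k * (q ^ k * jterm (int k - int n - 1))"
      by (simp only: g_def mult_ac)
    also have "\<dots> = b * q ^ n * (w (int k - int n - 1) * qbin (a * b) (m + n) k * jterm (int k - int n))"
      unfolding * by (simp only: N_def q_def mult_ac)
    finally show "q ^ k * qbin q N k * g k =
       b * q ^ n * (w (int k - int n - 1) * qbin (a * b) (m + n) k * jterm (int k - int n))" .
  qed (simp add: N_def)
  finally show ?thesis by (simp add: q_def add_ac)
qed

text \<open>A constant weight is invariant under the shifts, so each recursion step multiplies the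
  sum by one new factor.\<close>

lemma finite_triple_product:
  "jsum (\<lambda>_. 1) m n = (\<Prod>i<m. 1 + a * (a * b) ^ i) * (\<Prod>i<n. 1 + b * (a * b) ^ i)"
proof (induction m)
  case 0
  show ?case
  proof (induction n)
    case 0
    show ?case by (simp add: jsum_def jterm_def tri_def)
  next
    case (Suc n)
    then show ?case by (simp add: jsum_Suc_right algebra_simps)
  qed
next
  case (Suc m)
  then show ?case by (simp add: jsum_Suc_left algebra_simps)
qed

end

text \<open>The weight \<open>j\<close> plays the role of the derivative at \<open>z = 1\<close> in Jacobi's triple product.\<close>

lemma finite_jacobi_cube:
  fixes q :: "'a::comm_ring_1"
  shows "jsum (-1) (- q) of_int (Suc m) n = - (\<Prod>i<m. 1 - q ^ Suc i) * (\<Prod>i<n. 1 - q ^ Suc i)"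
proof -
  have lin: "jsum (-1) (- q) (\<lambda>j. of_int (j + 1)) m n =
      jsum (-1) (- q) of_int m n + jsum (-1) (- q) (\<lambda>_. 1) m n" for m
    by (simp add: jsum_def sum.distrib [symmetric] algebra_simps)
  show ?thesis
  proof (induction m)
    case 0
    show ?case
      by (subst jsum_Suc_left, subst lin) (simp add: finite_triple_product)
  next
    case (Suc m)
    \<comment> \<open>At a = -1 the factor 1 + a with index 0 is zero.\<close>
    have "jsum (-1) (- q) (\<lambda>_. 1) (Suc m) n = 0"
      by (simp add: finite_triple_product prod.lessThan_Suc_shift del: prod.lessThan_Suc)
    then show ?case
      by (subst jsum_Suc_left, subst lin) (simp add: Suc.IH algebra_simps)
  qed
qed

section \<open>Theta series and infinite products\<close>

definition euler_upto :: "nat \<Rightarrow> nat \<Rightarrow> int fps" where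
  "euler_upto s n = (\<Prod>i<n. 1 - fps_X ^ (s * Suc i))"

text \<open>
  The coefficient of \<open>q\<^sup>j\<close> no longer changes after the \<open>j\<close>-th partial product. Integer coefficients
  are needed to speak about divisibility.
\<close>

definition euler :: "nat \<Rightarrow> int fps" where
  "euler s = Abs_fps (\<lambda>j. fps_nth (euler_upto s j) j)"

lemma euler_upto_Suc: "euler_upto s (Suc n) = euler_upto s n * (1 - fps_X ^ (s * Suc n))"
  by (simp add: euler_upto_def)

lemma euler_nth_0: "fps_nth (euler s) 0 = 1"
  by (simp add: euler_def euler_upto_def)

lemma euler_nonzero: "euler s \<noteq> 0"
  using euler_nth_0[of s] by auto

lemma tendsto_euler:
  assumes "s > 0"
  shows "euler_upto s \<longlonglongrightarrow> euler s"
proof (rule tendsto_fpsI)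
  fix j
  have stable: "fps_nth (euler_upto s n) j = fps_nth (euler_upto s j) j" if "j \<le> n" for n
    using that
  proof (induction n rule: dec_induct)
    case (step n)
    have "1 * Suc n \<le> s * Suc n" using \<open>s > 0\<close> by (intro mult_le_mono1) simp
    then have "j < s * Suc n"
      using less_le_trans[of j "Suc n" "s * Suc n"] \<open>j \<le> n\<close> by (simp only: mult_1)
    then have "fps_nth (euler_upto s (Suc n)) j = fps_nth (euler_upto s n) j"
      unfolding euler_upto_Suc by (simp only: right_diff_distrib fps_sub_nth fps_X_power_mult_right_nth) simp
    then show ?case using step.IH by simp
  qed (rule refl)
  show "eventually (\<lambda>n. fps_nth (euler_upto s n) j = fps_nth (euler s) j) sequentially"
    using eventually_ge_at_top[of j]
    unfolding euler_def fps_nth_Abs_fps by eventually_elim (rule stable)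
qed

lemma tendsto_euler_comp:
  assumes "s > 0" "filterlim g sequentially sequentially"
  shows "(\<lambda>n. euler_upto s (g n)) \<longlonglongrightarrow> euler s"
  using filterlim_compose[OF tendsto_euler[OF assms(1)] assms(2)] .

text \<open>Multiplication by a series with constant term 1 acts triangularly on the coefficients,
  with 1 on the diagonal.\<close>

lemma fps_eq_0_upto_cancel:
  fixes z u :: "int fps"
  assumes "fps_nth u 0 = 1" "\<And>i. i \<le> N \<Longrightarrow> fps_nth (z * u) i = 0" "i \<le> N"
  shows "fps_nth z i = 0"
  using assms(3)
proof (induction i rule: less_induct)
  case (less i)
  have "0 = fps_nth (z * u) i" using assms(2) less.prems by simp
  also have "\<dots> = (\<Sum>j=0..i. fps_nth z j * fps_nth u (i - j))" by (simp add: fps_mult_nth)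
  also have "\<dots> = (\<Sum>j\<in>{i}. fps_nth z j * fps_nth u (i - j))"
    using less by (intro sum.mono_neutral_right) auto
  finally show ?case using assms(1) by simp
qed

text \<open>Replaces division of limits: \<open>u\<close> and \<open>v\<close> have the same limit,
  whose constant term is 1, so their quotient tends to 1.\<close>

lemma tendsto_1_cancel:
  fixes y u v :: "nat \<Rightarrow> int fps"
  assumes "\<forall>\<^sub>F n in sequentially. y n * u n = v n" "u \<longlonglongrightarrow> U" "v \<longlonglongrightarrow> U" "fps_nth U 0 = 1"
  shows "y \<longlonglongrightarrow> 1"
proof (rule tendsto_fpsI)
  fix N
  have "eventually (\<lambda>n. \<forall>i\<in>{0..N}. fps_nth (u n) i = fps_nth U i) sequentially"
       "eventually (\<lambda>n. \<forall>i\<in>{0..N}. fps_nth (v n) i = fps_nth U i) sequentially"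
    using assms(2,3) by (auto simp: tendsto_fps_iff eventually_ball_finite_distrib)
  with assms(1) show "eventually (\<lambda>n. fps_nth (y n) N = fps_nth 1 N) sequentially"
  proof eventually_elim
    case (elim n)
    have "fps_nth (y n - 1) N = 0"
    proof (rule fps_eq_0_upto_cancel)
      show "fps_nth (u n) 0 = 1" using elim assms(4) by auto
      show "fps_nth ((y n - 1) * u n) i = 0" if "i \<le> N" for i
        using elim that by (simp add: left_diff_distrib)
    qed simp
    then show ?case by simp
  qed
qed

text \<open>By \<open>qbin_factorial\<close> the binomial is (q)_(2n+1) / ((q)_(n+j) (q)_(n+1-j))
  with q = X^s, which tends to 1/(q)_infinity for each fixed j.\<close>

lemma tendsto_euler_qbin:
  assumes "s > 0"
  shows "(\<lambda>n. euler_upto s n * qbin (fps_X ^ s) (Suc n + n) (nat (int n + j))) \<longlonglongrightarrow> 1"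
proof (rule tendsto_1_cancel)
  define k where "k = (\<lambda>n. nat (int n + j))"
  define l where "l = (\<lambda>n. nat (int n + 1 - j))"
  have F: "(\<Prod>i<n. 1 - (fps_X ^ s) ^ Suc i) = euler_upto s n" for n
    by (simp only: euler_upto_def power_mult)
  show "\<forall>\<^sub>F n in sequentially. euler_upto s n * qbin (fps_X ^ s) (Suc n + n) (nat (int n + j)) *
      (euler_upto s (k n) * euler_upto s (l n)) = euler_upto s (Suc (2 * n)) * euler_upto s n"
    \<comment> \<open>For n >= |j| the truncation by \<open>nat\<close> is harmless, so
      \<open>k n\<close> and \<open>l n\<close> add up to 2n + 1.\<close>
    using eventually_ge_at_top[of "nat \<bar>j\<bar>"]
  proof eventually_elim
    case (elim n)
    have kn: "nat (int n + j) = k n" by (simp add: k_def)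
    from elim have "Suc n + n = k n + l n" "Suc (2 * n) = k n + l n" by (auto simp: k_def l_def)
    then show ?case
      using qbin_factorial[of "fps_X ^ s :: int fps" "k n" "l n", unfolded F]
      by (simp only: kn mult_ac)
  qed
  have k: "filterlim k sequentially sequentially" and l: "filterlim l sequentially sequentially"
  proof -
    have "filterlim (\<lambda>n. n - nat \<bar>j\<bar>) sequentially sequentially"
      by (rule filterlim_minus_const_nat_at_top)
    then show "filterlim k sequentially sequentially" "filterlim l sequentially sequentially"
      by (rule filterlim_at_top_mono, intro always_eventually allI, auto simp: k_def l_def)+
  qed
  have m: "filterlim (\<lambda>n::nat. Suc (2 * n)) sequentially sequentially"
    by (rule filterlim_subseq) (auto simp: strict_mono_def)
  show "(\<lambda>n. euler_upto s (k n) * euler_upto s (l n)) \<longlonglongrightarrow> euler s * euler s"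
    by (intro tendsto_mult_fps tendsto_euler_comp k l assms)
  show "(\<lambda>n. euler_upto s (Suc (2 * n)) * euler_upto s n) \<longlonglongrightarrow> euler s * euler s"
    by (intro tendsto_mult_fps tendsto_euler_comp tendsto_euler m assms)
qed (simp add: euler_nth_0)

section \<open>Theta series as formal sums over an index set\<close>

definition theta :: "('i \<Rightarrow> int) \<Rightarrow> ('i \<Rightarrow> nat) \<Rightarrow> int fps" where
  "theta c e = Abs_fps (\<lambda>n. \<Sum>i | e i = n. c i)"

text \<open>A sum over an infinite fibre would be 0 by convention; this condition makes
  \<open>theta\<close> the genuine formal sum.\<close>

definition fin_fibres :: "('i \<Rightarrow> nat) \<Rightarrow> bool" where
  "fin_fibres e \<longleftrightarrow> (\<forall>n. finite {i. e i \<le> n})"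

lemma fin_fibresD: "fin_fibres e \<Longrightarrow> finite {i. e i = n}"
  unfolding fin_fibres_def by (rule finite_subset[of _ "{i. e i \<le> n}"]) auto

lemma fin_fibresI:
  fixes e :: "int \<Rightarrow> nat"
  assumes "\<And>j. \<bar>j\<bar> \<le> int (e j) + 1"
  shows "fin_fibres e"
  unfolding fin_fibres_def
proof
  fix n
  have "{i. e i \<le> n} \<subseteq> {- int n - 1..int n + 1}"
  proof
    fix i assume "i \<in> {i. e i \<le> n}"
    with assms[of i] show "i \<in> {- int n - 1..int n + 1}" by auto
  qed
  then show "finite {i. e i \<le> n}" by (rule finite_subset) simp
qed

text \<open>A termwise limit: a fixed coefficient sees only finitely many j, and for each of them
  the binomial times the partial product tends to 1. The constants \<open>A\<close> and
  \<open>B\<close> carry signs and cancel in the base.\<close>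

lemma triple_product_limit:
  fixes A B :: int and \<alpha> \<beta> :: nat and w :: "int \<Rightarrow> int"
  assumes AB: "A * B = 1" and "\<beta> > 0"
  defines "s \<equiv> \<alpha> + \<beta>"
  shows "(\<lambda>n. euler_upto s n *
            jsum (fps_const A * fps_X ^ \<alpha>) (fps_const B * fps_X ^ \<beta>) (\<lambda>j. of_int (w j)) (Suc n) n)
         \<longlonglongrightarrow> theta (\<lambda>j. w j * A ^ tri (j + 1) * B ^ tri j) (\<lambda>j. \<alpha> * tri (j + 1) + \<beta> * tri j)"
proof (rule tendsto_fpsI)
  fix N
  define a where "a = fps_const A * fps_X ^ \<alpha>"
  define b where "b = fps_const B * fps_X ^ \<beta>"
  define c where "c = (\<lambda>j. w j * A ^ tri (j + 1) * B ^ tri j)"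
  define e where "e = (\<lambda>j. \<alpha> * tri (j + 1) + \<beta> * tri j)"
  define y where "y = (\<lambda>n j. euler_upto s n * qbin (fps_X ^ s) (Suc n + n) (nat (int n + j)))"
  define J where "J = {j. e j \<le> N}"
  have s: "s > 0" using \<open>\<beta> > 0\<close> by (simp add: s_def)
  have ab: "a * b = fps_X ^ s"
    using AB by (simp add: a_def b_def s_def power_add mult_ac)
  have wt: "of_int (w j) * jterm a b j = fps_const (c j) * fps_X ^ e j" for j
    by (simp add: jterm_def a_def b_def c_def e_def power_mult_distrib fps_const_power power_add power_mult
          fps_of_int [symmetric] fps_const_mult [symmetric] mult_ac del: fps_const_mult)
  have fin: "fin_fibres e"
  proof (rule fin_fibresI)
    fix j
    have "tri j \<le> \<beta> * tri j" using \<open>\<beta> > 0\<close> by simp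
    then show "\<bar>j\<bar> \<le> int (e j) + 1"
      using abs_le_tri[of j] unfolding e_def by linarith
  qed
  then have J: "finite J" by (simp add: J_def fin_fibres_def)
  have "\<forall>j\<in>J. \<forall>i\<in>{0..N}. eventually (\<lambda>n. fps_nth (y n j) i = fps_nth 1 i) sequentially"
    using tendsto_euler_qbin[OF s] unfolding y_def tendsto_fps_iff by blast
  then have "eventually (\<lambda>n. \<forall>j\<in>J. \<forall>i\<in>{0..N}. fps_nth (y n j) i = fps_nth 1 i) sequentially"
    using J by (simp add: eventually_ball_finite_distrib)
  \<comment> \<open>This puts all of \<open>J\<close> inside the summation window from -n to n +
    1.\<close>
  moreover have "eventually (\<lambda>n. \<forall>j\<in>J. n \<ge> nat \<bar>j\<bar>) sequentially"
    using J by (intro eventually_ball_finite ballI eventually_ge_at_top)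
  ultimately show "eventually (\<lambda>n. fps_nth (euler_upto s n * jsum a b (\<lambda>j. of_int (w j)) (Suc n) n) N =
     fps_nth (theta c e) N) sequentially"
  proof eventually_elim
    case (elim n)
    have "euler_upto s n * jsum a b (\<lambda>j. of_int (w j)) (Suc n) n =
        (\<Sum>k\<le>Suc n + n. y n (int k - int n) * (fps_const (c (int k - int n)) * fps_X ^ e (int k - int n)))"
      unfolding jsum_def sum_distrib_left wt [symmetric] ab y_def
      by (intro sum.cong refl) (simp add: mult_ac)
    also have "\<dots> = (\<Sum>j\<in>{- int n..int n + 1}. y n j * (fps_const (c j) * fps_X ^ e j))"
      by (rule sum.reindex_bij_witness[of _ "\<lambda>j. nat (j + int n)" "\<lambda>k. int k - int n"]) auto
    finally have "fps_nth (euler_upto s n * jsum a b (\<lambda>j. of_int (w j)) (Suc n) n) N =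
        (\<Sum>j\<in>{- int n..int n + 1}. if e j \<le> N then c j * fps_nth (y n j) (N - e j) else 0)"
      by (simp add: fps_sum_nth mult.left_commute[of _ "fps_const _"] fps_X_power_mult_right_nth not_less if_distrib cong: if_cong)
         (auto intro!: sum.cong)
    also have "\<dots> = (\<Sum>j\<in>J. c j * fps_nth (y n j) (N - e j))"
      using elim(2) J by (intro sum.mono_neutral_cong_right) (force simp: J_def)+
    \<comment> \<open>Since \<open>y n j\<close> agrees with 1 up to degree \<open>N\<close>, only
      exponents equal to \<open>N\<close> survive.\<close>
    also have "\<dots> = (\<Sum>j\<in>J. if e j = N then c j else 0)"
      using elim(1) by (intro sum.cong refl) (auto simp: J_def)
    also have "\<dots> = (\<Sum>j | e j = N. c j)"
      using J by (intro sum.mono_neutral_cong_right) (auto simp: J_def)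
    finally show ?case by (simp add: theta_def)
  qed
qed

lemma theta_add: "fin_fibres e \<Longrightarrow> theta c e + theta d e = theta (\<lambda>i. c i + d i) e"
  by (rule fps_ext) (simp add: theta_def sum.distrib)

lemma theta_cmult: "theta (\<lambda>i. k * c i) e = fps_const k * theta c e"
  by (rule fps_ext) (simp add: theta_def sum_distrib_left)

lemma theta_reindex:
  assumes "bij g"
  shows "theta (\<lambda>i. c (g i)) (\<lambda>i. e (g i)) = theta c e"
proof (rule fps_ext)
  fix n
  have "(\<Sum>i | e (g i) = n. c (g i)) = (\<Sum>i | e i = n. c i)"
    using assms
    by (intro sum.reindex_bij_witness[of _ "inv g" g])
       (auto simp: bij_is_surj surj_f_inv_f bij_is_inj inv_f_f)
  then show "fps_nth (theta (\<lambda>i. c (g i)) (\<lambda>i. e (g i))) n = fps_nth (theta c e) n"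
    by (simp add: theta_def)
qed

lemma theta_mult:
  assumes "fin_fibres e" "fin_fibres e'"
  shows "theta c e * theta c' e' = theta (\<lambda>(i, j). c i * c' j) (\<lambda>(i, j). e i + e' j)"
proof (rule fps_ext)
  fix n
  have "fps_nth (theta c e * theta c' e') n =
      (\<Sum>m\<le>n. (\<Sum>i | e i = m. c i) * (\<Sum>j | e' j = n - m. c' j))"
    by (simp add: theta_def fps_mult_nth atMost_atLeast0)
  also have "\<dots> = (\<Sum>m\<le>n. \<Sum>(i, j)\<in>{i. e i = m} \<times> {j. e' j = n - m}. c i * c' j)"
    by (simp add: sum_product sum.cartesian_product)
  also have "\<dots> = (\<Sum>(i, j)\<in>(\<Union>m\<in>{..n}. {i. e i = m} \<times> {j. e' j = n - m}). c i * c' j)"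
    using fin_fibresD[OF assms(1)] fin_fibresD[OF assms(2)] by (subst sum.UNION_disjoint) auto
  also have "(\<Union>m\<in>{..n}. {i. e i = m} \<times> {j. e' j = n - m}) = {p. (\<lambda>(i, j). e i + e' j) p = n}"
    by auto
  finally show "fps_nth (theta c e * theta c' e') n =
      fps_nth (theta (\<lambda>(i, j). c i * c' j) (\<lambda>(i, j). e i + e' j)) n"
    by (simp add: theta_def)
qed

lemma fin_fibres_add:
  assumes "fin_fibres e" "fin_fibres e'"
  shows "fin_fibres (\<lambda>(i, j). e i + e' j)"
  unfolding fin_fibres_def
proof
  fix n
  have "{p. (case p of (i, j) \<Rightarrow> e i + e' j) \<le> n} \<subseteq> {i. e i \<le> n} \<times> {j. e' j \<le> n}" by auto
  then show "finite {p. (case p of (i, j) \<Rightarrow> e i + e' j) \<le> n}"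
    by (rule finite_subset) (use assms in \<open>auto simp: fin_fibres_def\<close>)
qed

text \<open>Meant for double series over pairs (i, j), with \<open>f\<close>, \<open>g\<close>,
  \<open>h\<close> parametrising the three classes of i - j modulo 3.\<close>

lemma theta_split3:
  assumes fin: "fin_fibres e"
    and inj: "inj f" "inj g" "inj h"
    and "range f \<inter> range g = {}" "range f \<inter> range h = {}" "range g \<inter> range h = {}"
    and "range f \<union> range g \<union> range h = UNIV"
  shows "theta c e = theta (\<lambda>p. c (f p)) (\<lambda>p. e (f p)) + theta (\<lambda>p. c (g p)) (\<lambda>p. e (g p))
           + theta (\<lambda>p. c (h p)) (\<lambda>p. e (h p))"
proof (rule fps_ext)
  fix n
  let ?F = "f ` {p. e (f p) = n}" and ?G = "g ` {p. e (g p) = n}" and ?H = "h ` {p. e (h p) = n}"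
  have eq: "{p. e p = n} = ?F \<union> ?G \<union> ?H"
  proof (intro equalityI subsetI)
    fix p assume p: "p \<in> {p. e p = n}"
    have "p \<in> range f \<union> range g \<union> range h" using assms(8) by simp
    then show "p \<in> ?F \<union> ?G \<union> ?H" using p by (elim UnE rangeE) simp_all
  qed (elim UnE imageE; simp)
  have finU: "finite (?F \<union> ?G \<union> ?H)"
    unfolding eq [symmetric] by (rule fin_fibresD[OF fin])
  have sub: "?F \<subseteq> range f" "?G \<subseteq> range g" "?H \<subseteq> range h" by (intro image_mono subset_UNIV)+
  have "?F \<inter> ?G = {}" using Int_mono[OF sub(1,2)] by (simp only: assms(5) subset_empty)
  moreover have "?F \<inter> ?H = {}" using Int_mono[OF sub(1,3)] by (simp only: assms(6) subset_empty)
  moreover have "?G \<inter> ?H = {}" using Int_mono[OF sub(2,3)] by (simp only: assms(7) subset_empty)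
  ultimately have "(?F \<union> ?G) \<inter> ?H = {}" "?F \<inter> ?G = {}" by (simp_all only: Int_Un_distrib2 Un_empty)
  with finU have "(\<Sum>p | e p = n. c p) = sum c ?F + sum c ?G + sum c ?H"
    unfolding eq by (simp only: finite_Un sum.union_disjoint)
  also have "\<dots> = (\<Sum>p | e (f p) = n. c (f p)) + (\<Sum>p | e (g p) = n. c (g p)) + (\<Sum>p | e (h p) = n. c (h p))"
    by (simp add: sum.reindex inj_on_subset[OF inj(1)] inj_on_subset[OF inj(2)] inj_on_subset[OF inj(3)])
  finally show "fps_nth (theta c e) n = fps_nth (theta (\<lambda>p. c (f p)) (\<lambda>p. e (f p))
      + theta (\<lambda>p. c (g p)) (\<lambda>p. e (g p)) + theta (\<lambda>p. c (h p)) (\<lambda>p. e (h p))) n"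
    by (simp add: theta_def)
qed

section \<open>Identities of Jacobi, Euler and Gauss\<close>

definition sgn1 :: "int \<Rightarrow> int" where
  "sgn1 j = (if even j then 1 else -1)"

lemma sgn1_add: "sgn1 (i + j) = sgn1 i * sgn1 j"
  by (auto simp: sgn1_def)

lemma sgn1_diff: "sgn1 (i - j) = sgn1 i * sgn1 j"
  by (auto simp: sgn1_def)

lemma sgn1_mult_self: "sgn1 j * sgn1 j = 1"
  by (simp add: sgn1_def)

lemma sgn1_one: "sgn1 1 = -1"
  by (simp add: sgn1_def)

lemma minus_one_power_int: "(-1 :: int) ^ n = sgn1 (int n)"
  by (auto simp: sgn1_def)

text \<open>The sign left over in the triple product for A = B = -1; the two exponents differ by
  j.\<close>

lemma tri_signs: "(-1 :: int) ^ tri (j + 1) * (-1) ^ tri j = sgn1 j"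
  by (simp add: minus_one_power_int tri_step sgn1_add mult.commute mult.assoc sgn1_mult_self)

lemma fin_fibres_tri:
  assumes "k > 0"
  shows "fin_fibres (\<lambda>j. k * tri j)"
proof (rule fin_fibresI)
  fix j
  have "tri j \<le> k * tri j" using assms by simp
  then show "\<bar>j\<bar> \<le> int (k * tri j) + 1" using abs_le_tri[of j] by linarith
qed

text \<open>The reflection j -> 1 - j keeps \<open>tri j\<close> and reverses the sign, so the
  series is its own negative.\<close>

lemma theta_sgn1_tri:
  "theta sgn1 (\<lambda>j. s * tri j) = 0"
proof -
  have "bij (\<lambda>j::int. 1 - j)" by (rule o_bij[of "\<lambda>j. 1 - j"]) auto
  from theta_reindex[OF this, of sgn1 "\<lambda>j. s * tri j"]
  have "theta (\<lambda>j. - 1 * sgn1 j) (\<lambda>j. s * tri j) = theta sgn1 (\<lambda>j. s * tri j)"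
    by (simp add: tri_reflect sgn1_diff sgn1_one)
  then have "2 * theta sgn1 (\<lambda>j. s * tri j) = 0"
    unfolding theta_cmult by (simp add: fps_const_neg [symmetric] del: fps_const_neg)
  then show ?thesis by simp
qed

text \<open>The limit of \<open>finite_jacobi_cube\<close>. It is a bilateral form of Jacobi's
  series: j and 1 - j share an exponent and together have weight (-1)^j (2j - 1).\<close>

lemma jacobi_cube:
  assumes "s > 0"
  shows "theta (\<lambda>j. j * sgn1 j) (\<lambda>j. s * tri j) = - (euler s ^ 3)"
proof -
  have F: "(\<Prod>i<n. 1 - (fps_X ^ s) ^ Suc i) = euler_upto s n" for n
    by (simp only: euler_upto_def power_mult)
  have "(\<lambda>n. euler_upto s n * jsum (-1) (- (fps_X ^ s)) of_int (Suc n) n)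
      \<longlonglongrightarrow> theta (\<lambda>j. j * sgn1 j) (\<lambda>j. s * tri j)"
    using triple_product_limit[of "-1" "-1" s 0 "\<lambda>j. j"] assms
    by (simp add: tri_signs mult.assoc fps_const_neg [symmetric] del: fps_const_neg)
  then have "(\<lambda>n. euler_upto s n * euler_upto s n * (euler_upto s n * (-1)))
      \<longlonglongrightarrow> theta (\<lambda>j. j * sgn1 j) (\<lambda>j. s * tri j)"
    unfolding finite_jacobi_cube F by (simp add: mult_ac)
  moreover have "(\<lambda>n. euler_upto s n * euler_upto s n * (euler_upto s n * (-1)))
      \<longlonglongrightarrow> euler s * euler s * (euler s * (-1))"
    by (intro tendsto_mult_fps tendsto_euler assms tendsto_const)
  ultimately have "theta (\<lambda>j. j * sgn1 j) (\<lambda>j. s * tri j) = euler s * euler s * (euler s * (-1))"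
    by (rule LIMSEQ_unique)
  then show ?thesis by (simp add: power3_eq_cube)
qed

text \<open>The correction is a multiple of the vanishing \<open>theta_sgn1_tri\<close>. The weight
  2j - 1 is wanted because its square is linear in the exponent.\<close>

lemma jacobi_cube_symmetric:
  assumes "s > 0"
  shows "theta (\<lambda>j. (2 * j - 1) * sgn1 j) (\<lambda>j. s * tri j) = - 2 * euler s ^ 3"
proof -
  have "theta (\<lambda>j. (2 * j - 1) * sgn1 j) (\<lambda>j. s * tri j) =
     theta (\<lambda>j. 2 * (j * sgn1 j)) (\<lambda>j. s * tri j) + theta (\<lambda>j. -1 * sgn1 j) (\<lambda>j. s * tri j)"
    by (subst theta_add[OF fin_fibres_tri[OF assms]]) (simp add: algebra_simps)
  also have "\<dots> = - 2 * euler s ^ 3"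
    unfolding theta_cmult jacobi_cube[OF assms] theta_sgn1_tri numeral_fps_const [symmetric] by simp
  finally show ?thesis .
qed

text \<open>Jacobi's triple product, kept as a limit so that each application can first regroup the
  finite products.\<close>

lemma triple_product:
  fixes A B :: int and \<alpha> \<beta> :: nat
  assumes "A * B = 1" and "\<beta> > 0"
  defines "s \<equiv> \<alpha> + \<beta>"
  shows "(\<lambda>n. euler_upto s n * (\<Prod>i<Suc n. 1 + fps_const A * fps_X ^ (\<alpha> + s * i))
            * (\<Prod>i<n. 1 + fps_const B * fps_X ^ (\<beta> + s * i)))
         \<longlonglongrightarrow> theta (\<lambda>j. A ^ tri (j + 1) * B ^ tri j) (\<lambda>j. \<alpha> * tri (j + 1) + \<beta> * tri j)"
proof -
  have ab: "fps_const A * fps_X ^ \<alpha> * (fps_const B * fps_X ^ \<beta>) = fps_X ^ s"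
    using assms by (simp add: power_add mult_ac)
  show ?thesis
    using triple_product_limit[OF assms(1,2), of \<alpha> "\<lambda>_. 1"]
    unfolding s_def [symmetric] of_int_1 finite_triple_product ab power_add power_mult
    by (simp only: mult.assoc mult_1)
qed

text \<open>The triple product in base q^(3s): its three families of factors cover the multiples of
  s by residue modulo 3. The exponent is s j(3j-1)/2.\<close>

lemma euler_pentagonal:
  assumes "s > 0"
  shows "theta sgn1 (\<lambda>j. s * (tri (j + 1) + 2 * tri j)) = euler s"
proof -
  have fin: "euler_upto (3 * s) n * (\<Prod>i<Suc n. 1 - fps_X ^ (s + 3 * s * i))
            * (\<Prod>i<n. 1 - fps_X ^ (2 * s + 3 * s * i)) = euler_upto s (Suc (3 * n))" for n
  proof (induction n)
    case 0
    show ?case by (simp add: euler_upto_def)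
  next
    case (Suc n)
    have "euler_upto s (Suc (3 * Suc n)) = euler_upto s (Suc (3 * n)) * (1 - fps_X ^ (2 * s + 3 * s * n))
       * (1 - fps_X ^ (3 * s * Suc n)) * (1 - fps_X ^ (s + 3 * s * Suc n))"
    proof -
      have "Suc (3 * Suc n) = Suc (Suc (Suc (Suc (3 * n))))"
           "2 * s + 3 * s * n = s * Suc (Suc (3 * n))"
           "3 * s * Suc n = s * Suc (Suc (Suc (3 * n)))"
           "s + 3 * s * Suc n = s * Suc (Suc (Suc (Suc (3 * n))))"
        by (simp_all add: algebra_simps)
      then show ?thesis by (simp only: euler_upto_Suc)
    qed
    moreover have "euler_upto (3 * s) (Suc n) * (\<Prod>i<Suc (Suc n). 1 - fps_X ^ (s + 3 * s * i))
            * (\<Prod>i<Suc n. 1 - fps_X ^ (2 * s + 3 * s * i)) =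
        (euler_upto (3 * s) n * (\<Prod>i<Suc n. 1 - fps_X ^ (s + 3 * s * i))
            * (\<Prod>i<n. 1 - fps_X ^ (2 * s + 3 * s * i))) * (1 - fps_X ^ (2 * s + 3 * s * n))
       * (1 - fps_X ^ (3 * s * Suc n)) * (1 - fps_X ^ (s + 3 * s * Suc n))"
      by (simp only: euler_upto_Suc prod.lessThan_Suc mult_ac)
    ultimately show ?case using Suc.IH by (simp only:)
  qed
  have "(\<lambda>n. euler_upto s (Suc (3 * n))) \<longlonglongrightarrow> theta sgn1 (\<lambda>j. s * (tri (j + 1) + 2 * tri j))"
  proof -
    have "s + 2 * s = 3 * s" "s * tri (j + 1) + 2 * s * tri j = s * (tri (j + 1) + 2 * tri j)" for j
      by (simp_all add: algebra_simps)
    moreover have "1 + fps_const (-1) * z = 1 - z" for z :: "int fps"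
      by (simp add: fps_const_neg [symmetric] del: fps_const_neg)
    ultimately show ?thesis
      using triple_product[of "-1" "-1" "2 * s" s] assms unfolding fin [symmetric] tri_signs
      by (simp del: prod.lessThan_Suc fps_const_neg)
  qed
  moreover have "(\<lambda>n. euler_upto s (Suc (3 * n))) \<longlonglongrightarrow> euler s"
    by (intro tendsto_euler_comp assms filterlim_subseq) (auto simp: strict_mono_def)
  ultimately show ?thesis by (rule LIMSEQ_unique)
qed

text \<open>The series has exponents s j^2. In the triple product of base q^(2s) the odd multiples
  of s occur twice; each odd family is completed to \<open>euler s\<close> by one copy of
  \<open>euler (2 * s)\<close>, the second copy being the extra factor on the left.\<close>

lemma gauss_square:
  assumes "s > 0"
  shows "theta sgn1 (\<lambda>j. s * (tri (j + 1) + tri j)) * euler (2 * s) = euler s ^ 2"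
proof -
  have fin: "euler_upto (2 * s) n * (\<Prod>i<n. 1 - fps_X ^ (s + 2 * s * i)) = euler_upto s (2 * n)" for n
    by (induction n) (auto simp: euler_upto_def algebra_simps)
  have fin': "euler_upto (2 * s) n * (\<Prod>i<Suc n. 1 - fps_X ^ (s + 2 * s * i)) = euler_upto s (Suc (2 * n))" for n
    using fin[of n] by (simp add: euler_upto_Suc algebra_simps)
  have "(\<lambda>n. euler_upto (2 * s) n * (\<Prod>i<Suc n. 1 - fps_X ^ (s + 2 * s * i))
            * (\<Prod>i<n. 1 - fps_X ^ (s + 2 * s * i))) \<longlonglongrightarrow> theta sgn1 (\<lambda>j. s * (tri (j + 1) + tri j))"
  proof -
    have "s * tri (j + 1) + s * tri j = s * (tri (j + 1) + tri j)" for j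
      by (simp add: algebra_simps)
    moreover have "1 + fps_const (-1) * z = 1 - z" for z :: "int fps"
      by (simp add: fps_const_neg [symmetric] del: fps_const_neg)
    ultimately show ?thesis
      using triple_product[of "-1" "-1" s s, folded mult_2] assms unfolding tri_signs
      by (simp del: prod.lessThan_Suc fps_const_neg)
  qed
  then have "(\<lambda>n. euler_upto s (Suc (2 * n)) * (\<Prod>i<n. 1 - fps_X ^ (s + 2 * s * i)) * euler_upto (2 * s) n)
      \<longlonglongrightarrow> theta sgn1 (\<lambda>j. s * (tri (j + 1) + tri j)) * euler (2 * s)"
    unfolding fin' by (rule tendsto_mult_fps) (use assms in \<open>auto intro: tendsto_euler\<close>)
  then have "(\<lambda>n. euler_upto s (Suc (2 * n)) * euler_upto s (2 * n))
      \<longlonglongrightarrow> theta sgn1 (\<lambda>j. s * (tri (j + 1) + tri j)) * euler (2 * s)"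
    unfolding fin [symmetric] by (simp add: mult_ac)
  moreover have "(\<lambda>n. euler_upto s (Suc (2 * n)) * euler_upto s (2 * n)) \<longlonglongrightarrow> euler s * euler s"
    by (intro tendsto_mult_fps tendsto_euler_comp assms filterlim_subseq) (auto simp: strict_mono_def)
  ultimately show ?thesis unfolding power2_eq_square by (rule LIMSEQ_unique)
qed

text \<open>The triple product with a = 1: the factor 1 + a = 2 reflects that j and 1 - j give the
  same triangular number. The rest is (1 - q^i)(1 + q^i) = 1 - q^(2i).\<close>

lemma gauss_triangular: "theta (\<lambda>_. 1) tri * euler 1 = 2 * euler 2 ^ 2"
proof -
  have fin: "euler_upto 1 n * (\<Prod>i<n. 1 + fps_X ^ Suc i) = euler_upto 2 n" for n
  proof (induction n)
    case (Suc n)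
    have "(1 - fps_X ^ Suc n) * (1 + fps_X ^ Suc n) = (1 - fps_X ^ (2 * Suc n) :: int fps)"
    proof -
      have "(1 - z) * (1 + z) = 1 - z * z" for z :: "int fps" by (simp add: algebra_simps)
      then show ?thesis by (simp only: mult_2 power_add)
    qed
    then have "euler_upto 2 (Suc n) =
        euler_upto 1 n * (\<Prod>i<n. 1 + fps_X ^ Suc i) * ((1 - fps_X ^ Suc n) * (1 + fps_X ^ Suc n))"
      unfolding euler_upto_Suc Suc.IH by (simp only:)
    then show ?case
      unfolding euler_upto_Suc[of 1] prod.lessThan_Suc by (simp only: mult_ac mult_1)
  qed (simp add: euler_upto_def)
  have "(\<lambda>n. euler_upto 1 n * (\<Prod>i<Suc n. 1 + fps_X ^ i) * (\<Prod>i<n. 1 + fps_X ^ Suc i))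
      \<longlonglongrightarrow> theta (\<lambda>_. 1) tri"
    using triple_product[of 1 1 1 0] by (simp del: prod.lessThan_Suc)
  then have "(\<lambda>n. euler_upto 1 n * (\<Prod>i<Suc n. 1 + fps_X ^ i) * (\<Prod>i<n. 1 + fps_X ^ Suc i) * euler_upto 1 n)
      \<longlonglongrightarrow> theta (\<lambda>_. 1) tri * euler 1"
    by (rule tendsto_mult_fps) (auto intro: tendsto_euler)
  also have "(\<lambda>n. euler_upto 1 n * (\<Prod>i<Suc n. 1 + fps_X ^ i) * (\<Prod>i<n. 1 + fps_X ^ Suc i) * euler_upto 1 n)
     = (\<lambda>n. 2 * (euler_upto 2 n * euler_upto 2 n))"
    unfolding prod.lessThan_Suc_shift fin [symmetric] by (simp add: mult_ac)
  finally have "(\<lambda>n. 2 * (euler_upto 2 n * euler_upto 2 n)) \<longlonglongrightarrow> theta (\<lambda>_. 1) tri * euler 1" .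
  moreover have "(\<lambda>n. 2 * (euler_upto 2 n * euler_upto 2 n)) \<longlonglongrightarrow> 2 * (euler 2 * euler 2)"
    by (intro tendsto_mult_fps tendsto_euler tendsto_const) auto
  ultimately show ?thesis unfolding power2_eq_square by (rule LIMSEQ_unique)
qed

section \<open>Weight 3/2 theta quotients\<close>

lemma fin_fibres_tri_comb:
  assumes "a > 0 \<or> b > 0"
  shows "fin_fibres (\<lambda>j. a * tri (j + 1) + b * tri j + d)"
proof (rule fin_fibresI)
  fix j
  have "tri (j + 1) \<le> a * tri (j + 1) \<or> tri j \<le> b * tri j" using assms by auto
  then show "\<bar>j\<bar> \<le> int (a * tri (j + 1) + b * tri j + d) + 1"
    using abs_le_tri[of j] abs_le_tri_Suc[of j] by linarith
qed

lemma theta_mult_int: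
  fixes c c' :: "int \<Rightarrow> int"
  assumes "fin_fibres e" "fin_fibres e'"
    and "\<And>m k. C (m, k) = c m * c' k" "\<And>m k. E (m, k) = e m + e' k"
  shows "theta C E = theta c e * theta c' e'"
  unfolding theta_mult[OF assms(1,2)]
  using assms(3,4) by (intro arg_cong2[where f = theta] ext) auto

text \<open>
  Multiplying Jacobi's series for \<open>f\<^sub>1\<^sup>3\<close> by Gauss's series for \<open>f\<^sub>1\<^sup>2/f\<^sub>2\<close> gives a double sum over \<open>(i, j)\<close>,
  in which the weight \<open>i\<close> may be replaced by \<open>i + 2j\<close> because \<open>\<Sum>\<^sub>i (-1)\<^sup>i q\<^bsup>i(i-1)/2\<^esup> = 0\<close>. On each residue class
  of \<open>i + 2j\<close> modulo 3 a linear substitution separates the variables: two classes give the desired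
  series times \<open>f\<^sub>2\<close>, the third one vanishes.
\<close>

lemma pentagonal_weighted:
  assumes s: "s > 0"
  shows "theta (\<lambda>m. 6 * m + 1) (\<lambda>m. s * (2 * tri (m + 1) + tri m)) * euler (2 * s) ^ 2 = euler s ^ 5"
proof -
  define e1 where "e1 = (\<lambda>j. s * tri j)"
  define e2 where "e2 = (\<lambda>j. s * (tri (j + 1) + tri j))"
  define eS where "eS = (\<lambda>m. s * (2 * tri (m + 1) + tri m))"
  define eE where "eE = (\<lambda>j. 2 * s * (tri (j + 1) + 2 * tri j))"
  define e0 where "e0 = (\<lambda>m. s * (3 * tri (m + 1) + 1))"
  define e0' where "e0' = (\<lambda>k. 6 * s * tri k)"
  have fin: "fin_fibres e1" "fin_fibres e2" "fin_fibres eS" "fin_fibres eE" "fin_fibres e0" "fin_fibres e0'"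
    using fin_fibres_tri_comb[of 0 s 0] fin_fibres_tri_comb[of s s 0] fin_fibres_tri_comb[of "2 * s" s 0]
      fin_fibres_tri_comb[of "2 * s" "4 * s" 0] fin_fibres_tri_comb[of "3 * s" 0 s] fin_fibres_tri_comb[of 0 "6 * s" 0] s
    by (simp_all add: e1_def e2_def eS_def eE_def e0_def e0'_def algebra_simps)
  define C where "C = (\<lambda>(i, j). (i + 2 * j) * sgn1 (i + j))"
  define E where "E = (\<lambda>(i, j). e1 i + e2 j)"
  \<comment> \<open>The differences i - j are 3k, 1 - 3k and 2 - 3k. The coordinate m is chosen so
    that no term m k remains in tri i + j^2.\<close>
  define f :: "int \<times> int \<Rightarrow> int \<times> int" where "f = (\<lambda>(m, k). (2 * k - m, - m - k))"
  define g :: "int \<times> int \<Rightarrow> int \<times> int" where "g = (\<lambda>(m, k). (m + 1 - 2 * k, m + k))"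
  define h :: "int \<times> int \<Rightarrow> int \<times> int" where "h = (\<lambda>(m, k). (m + 2 - 2 * k, m + k))"
  define T where "T = theta (\<lambda>m. 6 * m + 1) eS"
  have "theta (\<lambda>i. i * sgn1 i) e1 * theta sgn1 e2 + theta sgn1 e1 * theta (\<lambda>j. 2 * j * sgn1 j) e2 = theta C E"
    unfolding theta_mult[OF fin(1,2)] E_def C_def
    by (subst theta_add[OF fin_fibres_add[OF fin(1,2)]])
       (simp add: case_prod_unfold sgn1_add algebra_simps)
  then have CE: "theta C E = - (euler s ^ 3) * theta sgn1 e2"
    unfolding e1_def jacobi_cube[OF s] theta_sgn1_tri by simp
  have "theta C E = theta (\<lambda>p. C (f p)) (\<lambda>p. E (f p)) + theta (\<lambda>p. C (g p)) (\<lambda>p. E (g p))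
      + theta (\<lambda>p. C (h p)) (\<lambda>p. E (h p))"
  proof (rule theta_split3)
    show "fin_fibres E" unfolding E_def by (rule fin_fibres_add[OF fin(1,2)])
    show "inj f" "inj g" "inj h" by (auto simp: inj_on_def f_def g_def h_def)
    show "range f \<inter> range g = {}" "range f \<inter> range h = {}" "range g \<inter> range h = {}"
      by (auto simp: f_def g_def h_def, presburger+)
    show "range f \<union> range g \<union> range h = UNIV"
    proof (intro equalityI subsetI UNIV_I)
      fix p :: "int \<times> int"
      obtain i j where p: "p = (i, j)" by force
      have "3 dvd (i - j) \<or> 3 dvd (i - j - 1) \<or> 3 dvd (i - j - 2)" by presburger
      then consider "3 dvd (i - j)" | "3 dvd (i - j - 1)" | "3 dvd (i - j - 2)" by blast
      then show "p \<in> range f \<union> range g \<union> range h"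
      proof cases
        case 1
        then obtain k where "i - j = 3 * k" by (elim dvdE)
        then have "p = f (- j - k, k)" by (simp add: p f_def)
        then show ?thesis by blast
      next
        case 2
        then obtain k where "i - j - 1 = 3 * k" by (elim dvdE)
        then have "p = g (j + k, - k)" by (simp add: p g_def)
        then show ?thesis by blast
      next
        case 3
        then obtain k where "i - j - 2 = 3 * k" by (elim dvdE)
        then have "p = h (j + k, - k)" by (simp add: p h_def)
        then show ?thesis by blast
      qed
    qed
  qed
  also have "theta (\<lambda>p. C (f p)) (\<lambda>p. E (f p)) = theta (\<lambda>m. - 3 * m) eS * theta sgn1 eE"
  proof (rule theta_mult_int[OF fin(3,4)])
    fix m k
    show "C (f (m, k)) = - 3 * m * sgn1 k" by (auto simp: C_def f_def sgn1_def)
    have "tri (2 * k - m) + (tri (- m - k + 1) + tri (- m - k)) =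
        2 * tri (m + 1) + tri m + 2 * (tri (k + 1) + 2 * tri k)"
      using two_tri[of "2 * k - m"] two_tri[of "- m - k + 1"] two_tri[of "- m - k"] two_tri[of m]
        two_tri[of "m + 1"] two_tri[of k] two_tri[of "k + 1"] by (simp add: algebra_simps)
    from arg_cong[OF this, of "\<lambda>x. s * x"] show "E (f (m, k)) = eS m + eE k"
      by (simp add: E_def f_def e1_def e2_def eS_def eE_def algebra_simps)
  qed
  also have "theta (\<lambda>p. C (g p)) (\<lambda>p. E (g p)) = theta (\<lambda>m. - (3 * m + 1)) eS * theta sgn1 eE"
  proof (rule theta_mult_int[OF fin(3,4)])
    fix m k
    show "C (g (m, k)) = - (3 * m + 1) * sgn1 k" by (auto simp: C_def g_def sgn1_def)
    have "tri (m + 1 - 2 * k) + (tri (m + k + 1) + tri (m + k)) =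
        2 * tri (m + 1) + tri m + 2 * (tri (k + 1) + 2 * tri k)"
      using two_tri[of "m + 1 - 2 * k"] two_tri[of "m + k + 1"] two_tri[of "m + k"] two_tri[of m]
        two_tri[of "m + 1"] two_tri[of k] two_tri[of "k + 1"] by (simp add: algebra_simps)
    from arg_cong[OF this, of "\<lambda>x. s * x"] show "E (g (m, k)) = eS m + eE k"
      by (simp add: E_def g_def e1_def e2_def eS_def eE_def algebra_simps)
  qed
  also have "theta (\<lambda>p. C (h p)) (\<lambda>p. E (h p)) = theta (\<lambda>m. 3 * m + 2) e0 * theta sgn1 e0'"
  proof (rule theta_mult_int[OF fin(5,6)])
    fix m k
    show "C (h (m, k)) = (3 * m + 2) * sgn1 k" by (auto simp: C_def h_def sgn1_def)
    have "tri (m + 2 - 2 * k) + (tri (m + k + 1) + tri (m + k)) = 3 * tri (m + 1) + 1 + 6 * tri k"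
      using two_tri[of "m + 2 - 2 * k"] two_tri[of "m + k + 1"] two_tri[of "m + k"]
        two_tri[of "m + 1"] two_tri[of k] by (simp add: algebra_simps)
    from arg_cong[OF this, of "\<lambda>x. s * x"] show "E (h (m, k)) = e0 m + e0' k"
      by (simp add: E_def h_def e1_def e2_def e0_def e0'_def algebra_simps)
  qed
  also have "theta sgn1 e0' = 0" unfolding e0'_def by (rule theta_sgn1_tri)
  also have "theta sgn1 eE = euler (2 * s)" unfolding eE_def using s by (intro euler_pentagonal) simp
  \<comment> \<open>The weights -3m and -(3m + 1) of the two surviving classes combine to -(6m +
    1).\<close>
  also have "theta (\<lambda>m. - 3 * m) eS * euler (2 * s) + theta (\<lambda>m. - (3 * m + 1)) eS * euler (2 * s)
      + theta (\<lambda>m. 3 * m + 2) e0 * 0 = theta (\<lambda>m. - 1 * (6 * m + 1)) eS * euler (2 * s)"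
    unfolding distrib_right [symmetric] theta_add[OF fin(3)] by (simp add: algebra_simps)
  also have "\<dots> = - (T * euler (2 * s))"
    unfolding theta_cmult T_def by (simp add: fps_const_neg [symmetric] del: fps_const_neg)
  finally have "T * euler (2 * s) = euler s ^ 3 * theta sgn1 e2"
    unfolding CE by simp
  then have "T * euler (2 * s) ^ 2 = euler s ^ 3 * (theta sgn1 e2 * euler (2 * s))"
    by (simp add: power2_eq_square mult_ac)
  also have "\<dots> = euler s ^ 5"
    unfolding e2_def gauss_square[OF s] by (simp add: power_add [symmetric])
  finally show ?thesis unfolding T_def eS_def .
qed

text \<open>
  The same argument for \<open>f\<^sub>2\<^sup>3\<close> times \<open>\<Sum>\<^sub>j q\<^bsup>j(j-1)/2\<^esup> = 2 f\<^sub>2\<^sup>2/f\<^sub>1\<close>, with weight \<open>i - j\<close>.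
\<close>

lemma octagonal_weighted:
  "theta (\<lambda>m. (3 * m + 1) * sgn1 m) (\<lambda>m. 5 * tri (m + 1) + tri m) * euler 1 ^ 2 = euler 2 ^ 5"
proof -
  define e1 where "e1 = (\<lambda>j. 2 * tri j)"
  define e2 where "e2 = (\<lambda>j. tri j)"
  define eT where "eT = (\<lambda>m. 5 * tri (m + 1) + tri m)"
  define eE where "eE = (\<lambda>j. 1 * (tri (j + 1) + 2 * tri j))"
  define e0 where "e0 = (\<lambda>m. 3 * (tri (m + 1) + tri m))"
  define e0' where "e0' = (\<lambda>k. 3 * tri k)"
  have fin: "fin_fibres e1" "fin_fibres e2" "fin_fibres eT" "fin_fibres eE" "fin_fibres e0" "fin_fibres e0'"
    using fin_fibres_tri_comb[of 0 2 0] fin_fibres_tri_comb[of 0 1 0] fin_fibres_tri_comb[of 5 1 0]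
      fin_fibres_tri_comb[of 1 2 0] fin_fibres_tri_comb[of 3 3 0] fin_fibres_tri_comb[of 0 3 0]
    by (simp_all add: e1_def e2_def eT_def eE_def e0_def e0'_def algebra_simps)
  define C where "C = (\<lambda>(i, j). (i - j) * sgn1 i)"
  define E where "E = (\<lambda>(i, j). e1 i + e2 j)"
  \<comment> \<open>Here i - j is 3m, 3m + 1 and -3m - 1, and no term m k remains in 2 tri i + tri
    j.\<close>
  define f :: "int \<times> int \<Rightarrow> int \<times> int" where "f = (\<lambda>(m, k). (m + k, k - 2 * m))"
  define g :: "int \<times> int \<Rightarrow> int \<times> int" where "g = (\<lambda>(m, k). (m + 1 - k, - 2 * m - k))"
  define h :: "int \<times> int \<Rightarrow> int \<times> int" where "h = (\<lambda>(m, k). (k - m, 1 + 2 * m + k))"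
  define T where "T = theta (\<lambda>m. (3 * m + 1) * sgn1 m) eT"
  have "theta (\<lambda>i. i * sgn1 i) e1 * theta (\<lambda>_. 1) e2 + theta sgn1 e1 * theta (\<lambda>j. - j) e2 = theta C E"
    unfolding theta_mult[OF fin(1,2)] E_def C_def
    by (subst theta_add[OF fin_fibres_add[OF fin(1,2)]])
       (simp add: case_prod_unfold algebra_simps)
  then have CE: "theta C E = - (euler 2 ^ 3) * theta (\<lambda>_. 1) tri"
    unfolding e1_def e2_def jacobi_cube[of 2, simplified] theta_sgn1_tri by simp
  have "theta C E = theta (\<lambda>p. C (f p)) (\<lambda>p. E (f p)) + theta (\<lambda>p. C (g p)) (\<lambda>p. E (g p))
      + theta (\<lambda>p. C (h p)) (\<lambda>p. E (h p))"
  proof (rule theta_split3)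
    show "fin_fibres E" unfolding E_def by (rule fin_fibres_add[OF fin(1,2)])
    show "inj f" "inj g" "inj h" by (auto simp: inj_on_def f_def g_def h_def)
    show "range f \<inter> range g = {}" "range f \<inter> range h = {}" "range g \<inter> range h = {}"
      by (auto simp: f_def g_def h_def, presburger+)
    show "range f \<union> range g \<union> range h = UNIV"
    proof (intro equalityI subsetI UNIV_I)
      fix p :: "int \<times> int"
      obtain i j where p: "p = (i, j)" by force
      have "3 dvd (i - j) \<or> 3 dvd (i - j - 1) \<or> 3 dvd (i - j - 2)" by presburger
      then consider "3 dvd (i - j)" | "3 dvd (i - j - 1)" | "3 dvd (i - j - 2)" by blast
      then show "p \<in> range f \<union> range g \<union> range h"
      proof cases
        case 1
        then obtain k where "i - j = 3 * k" by (elim dvdE)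
        then have "p = f (k, i - k)" by (simp add: p f_def)
        then show ?thesis by blast
      next
        case 2
        then obtain k where "i - j - 1 = 3 * k" by (elim dvdE)
        then have "p = g (k, k + 1 - i)" by (simp add: p g_def)
        then show ?thesis by blast
      next
        case 3
        then obtain k where "i - j - 2 = 3 * k" by (elim dvdE)
        then have "p = h (- k - 1, i - k - 1)" by (simp add: p h_def)
        then show ?thesis by blast
      qed
    qed
  qed
  also have "theta (\<lambda>p. C (f p)) (\<lambda>p. E (f p)) = theta (\<lambda>m. 3 * m * sgn1 m) e0 * theta sgn1 e0'"
  proof (rule theta_mult_int[OF fin(5,6)])
    fix m k
    show "C (f (m, k)) = 3 * m * sgn1 m * sgn1 k" by (auto simp: C_def f_def sgn1_def)
    show "E (f (m, k)) = e0 m + e0' k"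
      using two_tri[of "m + k"] two_tri[of "k - 2 * m"] two_tri[of m]
        two_tri[of "m + 1"] two_tri[of k]
      by (simp add: E_def f_def e1_def e2_def e0_def e0'_def algebra_simps)
  qed
  also have "theta (\<lambda>p. C (g p)) (\<lambda>p. E (g p)) = theta (\<lambda>m. - 1 * ((3 * m + 1) * sgn1 m)) eT * theta sgn1 eE"
  proof (rule theta_mult_int[OF fin(3,4)])
    fix m k
    show "C (g (m, k)) = - 1 * ((3 * m + 1) * sgn1 m) * sgn1 k" by (auto simp: C_def g_def sgn1_def)
    show "E (g (m, k)) = eT m + eE k"
      using two_tri[of "m + 1 - k"] two_tri[of "- 2 * m - k"] two_tri[of m]
        two_tri[of "m + 1"] two_tri[of k] two_tri[of "k + 1"]
      by (simp add: E_def g_def e1_def e2_def eT_def eE_def algebra_simps)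
  qed
  also have "theta (\<lambda>p. C (h p)) (\<lambda>p. E (h p)) = theta (\<lambda>m. - 1 * ((3 * m + 1) * sgn1 m)) eT * theta sgn1 eE"
  proof (rule theta_mult_int[OF fin(3,4)])
    fix m k
    show "C (h (m, k)) = - 1 * ((3 * m + 1) * sgn1 m) * sgn1 k" by (auto simp: C_def h_def sgn1_def)
    show "E (h (m, k)) = eT m + eE k"
      using two_tri[of "k - m"] two_tri[of "1 + 2 * m + k"] two_tri[of m]
        two_tri[of "m + 1"] two_tri[of k] two_tri[of "k + 1"]
      by (simp add: E_def h_def e1_def e2_def eT_def eE_def algebra_simps)
  qed
  also have "theta sgn1 e0' = 0" unfolding e0'_def by (rule theta_sgn1_tri)
  also have "theta sgn1 eE = euler 1" unfolding eE_def by (intro euler_pentagonal) simp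
  also have "theta (\<lambda>m. - 1 * ((3 * m + 1) * sgn1 m)) eT = - T"
    unfolding theta_cmult T_def by (simp add: fps_const_neg [symmetric] del: fps_const_neg)
  \<comment> \<open>\<open>g\<close> and \<open>h\<close> contribute the same series; the resulting
    2 cancels against the one in \<open>gauss_triangular\<close>.\<close>
  finally have "2 * (T * euler 1) = euler 2 ^ 3 * theta (\<lambda>_. 1) tri"
    unfolding CE by simp
  then have "2 * (T * euler 1 ^ 2) = euler 2 ^ 3 * (theta (\<lambda>_. 1) tri * euler 1)"
    by (simp add: power2_eq_square mult_ac)
  also have "\<dots> = 2 * euler 2 ^ 5"
    unfolding gauss_triangular by (simp add: power_add [symmetric] mult.left_commute)
  finally show ?thesis unfolding T_def eT_def by simp
qed

section \<open>The substitution of -q for q\<close>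

definition fps_flip :: "int fps \<Rightarrow> int fps" where
  "fps_flip F = Abs_fps (\<lambda>n. (-1) ^ n * fps_nth F n)"

lemma fps_flip_mult: "fps_flip (F * G) = fps_flip F * fps_flip G"
proof (rule fps_ext)
  fix n
  have "(-1) ^ n * (fps_nth F i * fps_nth G (n - i)) =
      ((-1) ^ i * fps_nth F i) * ((-1) ^ (n - i) * fps_nth G (n - i))" if "i \<le> n" for i
    using that power_add[of "-1 :: int" i "n - i"] by (simp add: mult_ac)
  then show "fps_nth (fps_flip (F * G)) n = fps_nth (fps_flip F * fps_flip G) n"
    unfolding fps_flip_def fps_mult_nth fps_nth_Abs_fps sum_distrib_left by (intro sum.cong) auto
qed

lemma fps_flip_power: "fps_flip (F ^ m) = fps_flip F ^ m"
proof (induction m)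
  case 0
  show ?case by (rule fps_ext) (simp add: fps_flip_def)
qed (simp add: fps_flip_mult)

lemma fps_flip_theta: "fps_flip (theta c e) = theta (\<lambda>i. (-1) ^ e i * c i) e"
  by (rule fps_ext) (auto simp: fps_flip_def theta_def sum_distrib_left)

lemma fps_flip_euler_factor:
  "fps_flip (1 - fps_X ^ k) = 1 - (-1) ^ k * fps_X ^ k"
  by (rule fps_ext) (cases "even k"; auto simp: fps_flip_def elim: oddE)

lemma tendsto_fps_flip: "(f \<longlongrightarrow> F) H \<Longrightarrow> ((\<lambda>x. fps_flip (f x)) \<longlongrightarrow> fps_flip F) H"
  unfolding tendsto_fps_iff by (auto simp: fps_flip_def elim: eventually_mono)

lemma fps_flip_euler_2: "fps_flip (euler 2) = euler 2"
proof (rule LIMSEQ_unique)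
  show "(\<lambda>n. fps_flip (euler_upto 2 n)) \<longlonglongrightarrow> fps_flip (euler 2)"
    by (intro tendsto_fps_flip tendsto_euler) simp
  have "fps_flip (euler_upto 2 n) = euler_upto 2 n" for n
  proof (induction n)
    case 0
    show ?case by (rule fps_ext) (simp add: fps_flip_def euler_upto_def)
  next
    case (Suc n)
    then show ?case unfolding euler_upto_Suc fps_flip_mult fps_flip_euler_factor by simp
  qed
  then show "(\<lambda>n. fps_flip (euler_upto 2 n)) \<longlonglongrightarrow> euler 2"
    using tendsto_euler[of 2] by simp
qed

text \<open>Factors with even exponent are unchanged, while 1 - q^r becomes 1 + q^r for odd r. The
  even factors give two copies of \<open>euler 2\<close>; the odd ones pair to 1 - q^(2r), and
  \<open>euler 4\<close> completes them to a third copy.\<close>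

lemma fps_flip_euler_1: "fps_flip (euler 1) * euler 1 * euler 4 = euler 2 ^ 3"
proof -
  have fin: "fps_flip (euler_upto 1 (2 * n)) * euler_upto 1 (2 * n) * euler_upto 4 n =
      euler_upto 2 n * euler_upto 2 n * euler_upto 2 (2 * n)" for n
  proof (induction n)
    case 0
    have "fps_flip 1 = 1" by (rule fps_ext) (simp add: fps_flip_def)
    then show ?case by (simp add: euler_upto_def)
  next
    case (Suc n)
    define x y :: "int fps" where "x = fps_X ^ Suc (2 * n)" and "y = fps_X ^ Suc (Suc (2 * n))"
    have pw: "2 * Suc n = Suc (Suc (2 * n))" by simp
    have x2: "fps_X ^ (2 * Suc (2 * n)) = x * x" and y2: "fps_X ^ (4 * Suc n) = y * y"
      and y2': "fps_X ^ (2 * Suc (Suc (2 * n))) = y * y"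
      by (simp_all only: x_def y_def power_add [symmetric]) (rule arg_cong[of _ _ "\<lambda>k. fps_X ^ k"], simp)+
    have E1: "euler_upto 1 (Suc (Suc (2 * n))) = euler_upto 1 (2 * n) * (1 - x) * (1 - y)"
      by (simp only: euler_upto_Suc x_def y_def mult_1)
    have F1: "fps_flip (euler_upto 1 (Suc (Suc (2 * n)))) = fps_flip (euler_upto 1 (2 * n)) * (1 + x) * (1 - y)"
      by (simp add: euler_upto_Suc fps_flip_mult fps_flip_euler_factor x_def y_def mult_1 del: power_Suc)
    have E4: "euler_upto 4 (Suc n) = euler_upto 4 n * (1 - y * y)"
      by (simp only: euler_upto_Suc y2)
    have E2: "euler_upto 2 (Suc n) = euler_upto 2 n * (1 - y)"
      by (simp only: euler_upto_Suc pw y_def)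
    have E22: "euler_upto 2 (Suc (Suc (2 * n))) = euler_upto 2 (2 * n) * (1 - x * x) * (1 - y * y)"
      by (simp only: euler_upto_Suc x2 y2')
    have xx: "(1 - x) * (1 + x) = 1 - x * x" by (simp add: algebra_simps)
    have "fps_flip (euler_upto 1 (2 * Suc n)) * euler_upto 1 (2 * Suc n) * euler_upto 4 (Suc n) =
        (fps_flip (euler_upto 1 (2 * n)) * euler_upto 1 (2 * n) * euler_upto 4 n) *
        ((1 - x) * (1 + x)) * ((1 - y) * (1 - y) * (1 - y * y))"
      unfolding pw F1 unfolding E1 E4 by (simp only: mult_ac)
    also have "\<dots> = euler_upto 2 (Suc n) * euler_upto 2 (Suc n) * euler_upto 2 (2 * Suc n)"
      unfolding Suc.IH xx pw E2 E22 by (simp only: mult_ac)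
    finally show ?case .
  qed
  have dbl: "filterlim (\<lambda>n::nat. 2 * n) sequentially sequentially"
    by (rule filterlim_subseq) (auto simp: strict_mono_def)
  have "(\<lambda>n. fps_flip (euler_upto 1 (2 * n)) * euler_upto 1 (2 * n) * euler_upto 4 n)
      \<longlonglongrightarrow> fps_flip (euler 1) * euler 1 * euler 4"
    by (intro tendsto_mult_fps tendsto_fps_flip tendsto_euler_comp[OF _ dbl] tendsto_euler) simp_all
  moreover have "(\<lambda>n. fps_flip (euler_upto 1 (2 * n)) * euler_upto 1 (2 * n) * euler_upto 4 n)
      \<longlonglongrightarrow> euler 2 * euler 2 * euler 2"
    unfolding fin by (intro tendsto_mult_fps tendsto_euler_comp[OF _ dbl] tendsto_euler) simp_all
  ultimately show ?thesis unfolding power3_eq_cube by (rule LIMSEQ_unique)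
qed

text \<open>The exponent m(3m + 2) has the parity of m, so the substitution q -> -q removes the sign
  and sends the first series to the second. \<open>fps_flip_euler_1\<close> then eliminates the
  flipped product, and nonzero powers of \<open>euler\<close> are cancelled.\<close>

lemma theta_mult_octagonal:
  "theta (\<lambda>m. (3 * m + 1) * sgn1 m) (\<lambda>m. 5 * tri (m + 1) + tri m) *
   theta (\<lambda>m. 3 * m + 1) (\<lambda>m. 5 * tri (m + 1) + tri m) = euler 2 ^ 4 * euler 4 ^ 2" (is "?T * ?T' = _")
  and theta_mult_octagonal_pentagonal:
  "theta (\<lambda>m. 3 * m + 1) (\<lambda>m. 5 * tri (m + 1) + tri m) *
   theta (\<lambda>m. 6 * m + 1) (\<lambda>m. 2 * (2 * tri (m + 1) + tri m)) = euler 1 ^ 2 * euler 2 ^ 4" (is "_ * ?S = _")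
proof -
  have "fps_flip ?T = ?T'"
    unfolding fps_flip_theta
  proof (intro arg_cong2[where f = theta] ext refl)
    fix m
    have "(-1) ^ (5 * tri (m + 1) + tri m) = sgn1 m"
      unfolding minus_one_power_int using tri_step[of m] by (simp add: sgn1_def)
    then show "(-1) ^ (5 * tri (m + 1) + tri m) * ((3 * m + 1) * sgn1 m) = 3 * m + 1"
      using sgn1_mult_self[of m] by (simp add: mult.left_commute)
  qed
  define F where "F = fps_flip (euler 1)"
  have T: "?T * euler 1 ^ 2 = euler 2 ^ 5" by (rule octagonal_weighted)
  have T': "?T' * F ^ 2 = euler 2 ^ 5"
    using arg_cong[OF T, of fps_flip] \<open>fps_flip ?T = ?T'\<close>
    by (simp add: fps_flip_mult fps_flip_power fps_flip_euler_2 F_def)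
  have F: "F * euler 1 * euler 4 = euler 2 ^ 3" unfolding F_def by (rule fps_flip_euler_1)
  have S: "?S * euler 4 ^ 2 = euler 2 ^ 5" using pentagonal_weighted[of 2] by simp
  have F2: "F ^ 2 * euler 1 ^ 2 * euler 4 ^ 2 = euler 2 ^ 6"
    using arg_cong[OF F, of "\<lambda>x. x ^ 2"] by (simp add: power_mult_distrib)
  have "(?T * ?T') * euler 2 ^ 6 = (?T * euler 1 ^ 2) * (?T' * F ^ 2) * euler 4 ^ 2"
    unfolding F2 [symmetric] by (simp only: mult_ac)
  also have "\<dots> = (euler 2 ^ 4 * euler 4 ^ 2) * euler 2 ^ 6"
    unfolding T T' by (simp add: mult_ac power_add [symmetric])
  finally show "?T * ?T' = euler 2 ^ 4 * euler 4 ^ 2" using euler_nonzero[of 2] by simp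
  have "(?T' * ?S) * (euler 2 ^ 6 * euler 4 ^ 2) =
      (?T' * F ^ 2) * (?S * euler 4 ^ 2) * (euler 1 ^ 2 * euler 4 ^ 2)"
    unfolding F2 [symmetric] by (simp only: mult_ac)
  also have "\<dots> = (euler 1 ^ 2 * euler 2 ^ 4) * (euler 2 ^ 6 * euler 4 ^ 2)"
    unfolding S T' by (simp add: mult_ac power_add [symmetric])
  finally show "?T' * ?S = euler 1 ^ 2 * euler 2 ^ 4"
    using euler_nonzero[of 2] euler_nonzero[of 4] by simp
qed

section \<open>Divisibility by 7\<close>

lemma theta_compose_square: "theta c e oo fps_X ^ 2 = theta c (\<lambda>i. 2 * e i)"
proof (rule fps_ext)
  fix n
  show "fps_nth (theta c e oo fps_X ^ 2) n = fps_nth (theta c (\<lambda>i. 2 * e i)) n"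
  proof (cases "even n")
    case True
    then obtain m where "n = 2 * m" by (elim evenE)
    then show ?thesis by (simp add: theta_def fps_nth_compose_X_power)
  next
    case False
    then have "{i. 2 * e i = n} = {}" by auto
    with False show ?thesis by (simp add: theta_def fps_nth_compose_X_power)
  qed
qed

text \<open>In the pentagonal number series the substitution q -> q^2 merely doubles the exponents,
  so no infinite product has to be composed.\<close>

lemma euler_compose_square: "s > 0 \<Longrightarrow> euler s oo fps_X ^ 2 = euler (2 * s)"
  using euler_pentagonal[of s] euler_pentagonal[of "2 * s"]
    theta_compose_square[of sgn1 "\<lambda>j. s * (tri (j + 1) + 2 * tri j)"]
  by (simp add: mult.assoc)

text \<open>Multiplied by n, the coefficient becomes one of the derivative 7 F^6 F', and n is
  invertible modulo 7.\<close>

lemma seven_dvd_power7_nth: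
  fixes F :: "int fps"
  assumes "\<not> 7 dvd n"
  shows "7 dvd fps_nth (F ^ 7) n"
proof -
  obtain m where m: "n = Suc m" using assms by (cases n) auto
  have "int n * fps_nth (F ^ 7) n = fps_nth (fps_deriv (F ^ 7)) m"
    by (simp add: m)
  also have "fps_deriv (F ^ 7) = fps_const 7 * (fps_deriv F * F ^ 6)"
    by (simp add: fps_deriv_power mult_ac)
  finally have "7 dvd int n * fps_nth (F ^ 7) n" by simp
  moreover have "coprime 7 (int n)"
  proof (rule prime_imp_coprime)
    show "prime (7 :: int)" by simp
    show "\<not> 7 dvd int n" using assms by presburger
  qed
  ultimately show ?thesis by (simp add: coprime_dvd_mult_right_iff)
qed

text \<open>In the convolution, shifts not divisible by 7 contribute multiples of 7 by
  \<open>seven_dvd_power7_nth\<close>, and positive multiples of 7 lead to smaller indices of the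
  same class, settled by induction.\<close>

lemma seven_dvd_nth_cancel:
  fixes A F :: "int fps"
  assumes "r < 7" "fps_nth F 0 = 1" "\<And>n. 7 dvd fps_nth (A * F ^ 7) (7 * n + r)"
  shows "7 dvd fps_nth A (7 * n + r)"
proof (induction n rule: less_induct)
  case (less n)
  let ?N = "7 * n + r"
  have "fps_nth (A * F ^ 7) ?N = (\<Sum>i=0..?N. fps_nth A i * fps_nth (F ^ 7) (?N - i))"
    by (rule fps_mult_nth)
  also have "\<dots> = fps_nth A ?N + (\<Sum>i\<in>{0..<?N}. fps_nth A i * fps_nth (F ^ 7) (?N - i))"
    using assms(2) by (simp add: fps_power_zeroth sum.last_plus atLeastLessThanSuc_atLeastAtMost [symmetric])
  finally have "fps_nth A ?N = fps_nth (A * F ^ 7) ?N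
      - (\<Sum>i\<in>{0..<?N}. fps_nth A i * fps_nth (F ^ 7) (?N - i))" by simp
  moreover have "7 dvd (\<Sum>i\<in>{0..<?N}. fps_nth A i * fps_nth (F ^ 7) (?N - i))"
  proof (rule dvd_sum)
    fix i assume i: "i \<in> {0..<?N}"
    show "7 dvd fps_nth A i * fps_nth (F ^ 7) (?N - i)"
    proof (cases "7 dvd ?N - i")
      case True
      then obtain d where d: "?N - i = 7 * d" by (elim dvdE)
      with i have "d > 0" by (cases d) simp_all
      \<comment> \<open>Since r < 7, going down from 7n + r by 7d lands on 7(n - d) + r without
        truncation.\<close>
      have "d \<le> n" using d assms(1) by linarith
      have "i < ?N" using i by simp
      with d \<open>d \<le> n\<close> have "i = 7 * (n - d) + r" by (simp add: diff_mult_distrib2)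
      then show ?thesis using less[of "n - d"] \<open>d > 0\<close> \<open>d \<le> n\<close> by simp
    qed (simp add: seven_dvd_power7_nth)
  qed
  ultimately show ?case using assms(3)[of n] by (simp only: dvd_diff)
qed

lemma seven_dvd_theta_mult_nth:
  assumes "fin_fibres e" "fin_fibres e'"
    and "\<And>i j. e i + e' j = N \<Longrightarrow> 7 dvd c i * c' j"
  shows "7 dvd fps_nth (theta c e * theta c' e') N"
  unfolding theta_mult[OF assms(1,2)] using assms(3) by (auto simp: theta_def intro!: dvd_sum)

text \<open>The reason is that -1 is not a square modulo 7; all pairs of residues are
  checked.\<close>

lemma seven_dvd_sum_squares:
  fixes x y :: int
  assumes "7 dvd x ^ 2 + y ^ 2"
  shows "7 dvd x" "7 dvd y"
proof -
  define a b where "a = x mod 7" and "b = y mod 7"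
  have "a = 0 \<or> a = 1 \<or> a = 2 \<or> a = 3 \<or> a = 4 \<or> a = 5 \<or> a = 6"
       "b = 0 \<or> b = 1 \<or> b = 2 \<or> b = 3 \<or> b = 4 \<or> b = 5 \<or> b = 6"
    unfolding a_def b_def by presburger+
  moreover have "(a ^ 2 + b ^ 2) mod 7 = 0"
  proof -
    have "(a ^ 2 + b ^ 2) mod 7 = (x ^ 2 + y ^ 2) mod 7"
      unfolding a_def b_def by (intro mod_add_cong power_mod)
    then show ?thesis using assms by (simp only: dvd_eq_mod_eq_0)
  qed
  ultimately have "a = 0 \<and> b = 0" by (elim disjE) simp_all
  then show "7 dvd x" "7 dvd y" by (auto simp: a_def b_def)
qed

text \<open>The reason is that -2 is not a square modulo 7.\<close>

lemma seven_dvd_square_plus_twice_square: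
  fixes x y :: int
  assumes "7 dvd x ^ 2 + 2 * y ^ 2"
  shows "7 dvd x"
proof -
  define a b where "a = x mod 7" and "b = y mod 7"
  have "a = 0 \<or> a = 1 \<or> a = 2 \<or> a = 3 \<or> a = 4 \<or> a = 5 \<or> a = 6"
       "b = 0 \<or> b = 1 \<or> b = 2 \<or> b = 3 \<or> b = 4 \<or> b = 5 \<or> b = 6"
    unfolding a_def b_def by presburger+
  moreover have "(a ^ 2 + 2 * b ^ 2) mod 7 = 0"
  proof -
    have "(a ^ 2 + 2 * b ^ 2) mod 7 = (x ^ 2 + 2 * y ^ 2) mod 7"
      unfolding a_def b_def by (intro mod_add_cong mod_mult_cong power_mod refl)
    then show ?thesis using assms by (simp only: dvd_eq_mod_eq_0)
  qed
  ultimately have "a = 0" by (elim disjE) simp_all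
  then show "7 dvd x" by (auto simp: a_def)
qed

text \<open>The two symmetric Jacobi series multiply to four times the product of cubes, and 4 is
  prime to 7.\<close>

lemma seven_dvd_cubes_nth:
  assumes "s > 0" "t > 0"
    and "\<And>i j. s * tri i + t * tri j = N \<Longrightarrow> 7 dvd 2 * i - 1"
  shows "7 dvd fps_nth (euler s ^ 3 * euler t ^ 3) N"
proof -
  have "7 dvd fps_nth (theta (\<lambda>j. (2 * j - 1) * sgn1 j) (\<lambda>j. s * tri j) *
      theta (\<lambda>j. (2 * j - 1) * sgn1 j) (\<lambda>j. t * tri j)) N"
    using assms by (intro seven_dvd_theta_mult_nth fin_fibres_tri) auto
  also have "theta (\<lambda>j. (2 * j - 1) * sgn1 j) (\<lambda>j. s * tri j) *
      theta (\<lambda>j. (2 * j - 1) * sgn1 j) (\<lambda>j. t * tri j) = fps_const 4 * (euler s ^ 3 * euler t ^ 3)"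
    unfolding jacobi_cube_symmetric[OF assms(1)] jacobi_cube_symmetric[OF assms(2)]
      numeral_fps_const [symmetric] by simp
  finally have "7 dvd 4 * fps_nth (euler s ^ 3 * euler t ^ 3) N" by (simp only: fps_mult_left_const_nth)
  then show ?thesis by presburger
qed

section \<open>Completed squares and the five residue classes\<close>

lemma square_eq_tri: "(2 * j - 1) ^ 2 = 8 * int (tri j) + 1"
  using two_tri[of j] by (simp add: power2_eq_square algebra_simps)

lemma square_eq_octagonal: "(3 * m + 1) ^ 2 = 3 * int (5 * tri (m + 1) + tri m) + 1"
  using two_tri[of m] two_tri[of "m + 1"] by (simp add: power2_eq_square algebra_simps)

lemma square_eq_pentagonal: "(6 * m + 1) ^ 2 = 12 * int (2 * (2 * tri (m + 1) + tri m)) + 1"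
  using two_tri[of m] two_tri[of "m + 1"] by (simp add: power2_eq_square algebra_simps)

lemma fin_fibres_octagonal: "fin_fibres (\<lambda>m. 5 * tri (m + 1) + tri m)"
  using fin_fibres_tri_comb[of 5 1 0] by simp

lemma seven_dvd_euler_1_6: "7 dvd fps_nth (euler 1 ^ 6) (7 * n + 5)"
proof -
  have "7 dvd fps_nth (euler 1 ^ 3 * euler 1 ^ 3) (7 * n + 5)"
  proof (rule seven_dvd_cubes_nth)
    fix i j assume eq: "1 * tri i + 1 * tri j = 7 * n + 5"
    \<comment> \<open>Each square adds 1 to eight times its exponent: 8 (7n + 5) + 2 = 7 (8n +
      6).\<close>
    have *: "(2 * i - 1) ^ 2 + (2 * j - 1) ^ 2 = 7 * (8 * int n + 6)"
      using arg_cong[OF eq, of int] unfolding square_eq_tri by simp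
    show "7 dvd 2 * i - 1" by (rule seven_dvd_sum_squares(1)[of _ "2 * j - 1"]) (simp only: * dvd_triv_left)
  qed simp_all
  then show ?thesis unfolding power_add [symmetric] by simp
qed

lemma seven_dvd_euler_2_6: "7 dvd fps_nth (euler 2 ^ 6) (7 * n + 3)"
proof -
  have "7 dvd fps_nth (euler 2 ^ 3 * euler 2 ^ 3) (7 * n + 3)"
  proof (rule seven_dvd_cubes_nth)
    fix i j assume eq: "2 * tri i + 2 * tri j = 7 * n + 3"
    have *: "(2 * i - 1) ^ 2 + (2 * j - 1) ^ 2 = 7 * (4 * int n + 2)"
      using arg_cong[OF eq, of int] unfolding square_eq_tri by simp
    show "7 dvd 2 * i - 1" by (rule seven_dvd_sum_squares(1)[of _ "2 * j - 1"]) (simp only: * dvd_triv_left)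
  qed simp_all
  then show ?thesis unfolding power_add [symmetric] by simp
qed

lemma seven_dvd_euler_1_3_2_3: "7 dvd fps_nth (euler 1 ^ 3 * euler 2 ^ 3) (7 * n + 4)"
proof (rule seven_dvd_cubes_nth)
  fix i j assume eq: "1 * tri i + 2 * tri j = 7 * n + 4"
  \<comment> \<open>The constants add up to 1 + 2: 8 (7n + 4) + 3 = 7 (8n + 5).\<close>
  have *: "(2 * i - 1) ^ 2 + 2 * (2 * j - 1) ^ 2 = 7 * (8 * int n + 5)"
    using arg_cong[OF eq, of int] unfolding square_eq_tri by simp
  show "7 dvd 2 * i - 1" by (rule seven_dvd_square_plus_twice_square[of _ "2 * j - 1"]) (simp only: * dvd_triv_left)
qed simp_all

lemma seven_dvd_euler_1_2_2_4: "7 dvd fps_nth (euler 1 ^ 2 * euler 2 ^ 4) (7 * n + 6)"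
  unfolding theta_mult_octagonal_pentagonal [symmetric]
proof (rule seven_dvd_theta_mult_nth)
  show "fin_fibres (\<lambda>m. 2 * (2 * tri (m + 1) + tri m))"
    using fin_fibres_tri_comb[of 4 2 0] by (simp add: algebra_simps)
  fix i j :: int assume eq: "5 * tri (i + 1) + tri i + 2 * (2 * tri (j + 1) + tri j) = 7 * n + 6"
  \<comment> \<open>Doubling the first weight gives both exponents the coefficient 12; then 12 (7n +
    6) + 5 = 7 (12n + 11).\<close>
  have *: "(2 * (3 * i + 1)) ^ 2 + (6 * j + 1) ^ 2 = 7 * (12 * int n + 11)"
    using arg_cong[OF eq, of int] unfolding power_mult_distrib square_eq_octagonal square_eq_pentagonal by simp
  have "7 dvd 6 * j + 1" by (rule seven_dvd_sum_squares(2)[of "2 * (3 * i + 1)"]) (simp only: * dvd_triv_left)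
  then show "7 dvd (3 * i + 1) * (6 * j + 1)" by simp
qed (rule fin_fibres_octagonal)

text \<open>\<open>theta_mult_octagonal\<close> yields the wanted series at q^2, hence the detour
  through the exponent 2 (7n + 2).\<close>

lemma seven_dvd_euler_1_4_2_2: "7 dvd fps_nth (euler 1 ^ 4 * euler 2 ^ 2) (7 * n + 2)"
proof -
  have "7 dvd fps_nth (euler 2 ^ 4 * euler 4 ^ 2) (2 * (7 * n + 2))"
    unfolding theta_mult_octagonal [symmetric]
  proof (rule seven_dvd_theta_mult_nth)
    fix i j :: int assume eq: "5 * tri (i + 1) + tri i + (5 * tri (j + 1) + tri j) = 2 * (7 * n + 2)"
    have *: "(3 * i + 1) ^ 2 + (3 * j + 1) ^ 2 = 7 * (6 * int n + 2)"
      using arg_cong[OF eq, of int] unfolding square_eq_octagonal by simp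
    have "7 dvd 3 * j + 1" by (rule seven_dvd_sum_squares(2)[of "3 * i + 1"]) (simp only: * dvd_triv_left)
    then show "7 dvd (3 * i + 1) * sgn1 i * (3 * j + 1)" by simp
  qed (rule fin_fibres_octagonal)+
  also have "euler 2 ^ 4 * euler 4 ^ 2 = (euler 1 ^ 4 * euler 2 ^ 2) oo fps_X ^ 2"
  proof -
    have "euler 1 oo fps_X ^ 2 = euler 2" "euler 2 oo fps_X ^ 2 = euler 4"
      using euler_compose_square[of 1] euler_compose_square[of 2] by simp_all
    moreover have "fps_nth (fps_X ^ 2 :: int fps) 0 = 0" by simp
    ultimately show ?thesis
      by (simp only: fps_compose_mult_distrib fps_compose_power [symmetric])
  qed
  also have "fps_nth \<dots> (2 * (7 * n + 2)) = fps_nth (euler 1 ^ 4 * euler 2 ^ 2) (7 * n + 2)"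
    unfolding fps_nth_compose_X_power by simp
  finally show ?thesis .
qed

section \<open>Passage to rational coefficients\<close>

definition fps_of_int_fps :: "int fps \<Rightarrow> rat fps" where
  "fps_of_int_fps F = Abs_fps (\<lambda>n. of_int (fps_nth F n))"

lemma fps_of_int_fps_mult: "fps_of_int_fps (F * G) = fps_of_int_fps F * fps_of_int_fps G"
  by (rule fps_ext) (simp add: fps_of_int_fps_def fps_mult_nth)

lemma fps_of_int_fps_power: "fps_of_int_fps (F ^ m) = fps_of_int_fps F ^ m"
proof (induction m)
  case 0
  show ?case by (rule fps_ext) (simp add: fps_of_int_fps_def)
qed (simp add: fps_of_int_fps_mult)

lemma fps_of_int_fps_inject: "fps_of_int_fps F = fps_of_int_fps G \<Longrightarrow> F = G"
  by (simp add: fps_of_int_fps_def fps_eq_iff)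

text \<open>Identifies the coefficientwise \<open>euler\<close> with the topological infinite
  product: both are limits of the same partial products.\<close>

lemma fps_of_int_fps_euler:
  assumes "m > 0"
  shows "fps_of_int_fps (euler m) = q_Pochhammer_inf (fps_X ^ m) (fps_X ^ m)"
proof (rule LIMSEQ_unique)
  have "fps_of_int_fps (euler_upto m n) = (\<Prod>i<n. 1 - fps_X ^ m * (fps_X ^ m) ^ i)" for n
  proof (induction n)
    case 0
    show ?case by (rule fps_ext) (simp add: fps_of_int_fps_def euler_upto_def)
  next
    case (Suc n)
    have "fps_of_int_fps (1 - fps_X ^ (m * Suc n)) = 1 - fps_X ^ (m * Suc n)"
      by (rule fps_ext) (simp add: fps_of_int_fps_def)
    also have "\<dots> = 1 - fps_X ^ m * (fps_X ^ m) ^ n" by (simp only: power_mult power_Suc)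
    finally show ?case using Suc by (simp only: euler_upto_Suc fps_of_int_fps_mult prod.lessThan_Suc)
  qed
  then show "(\<lambda>n. fps_of_int_fps (euler_upto m n)) \<longlonglongrightarrow> q_Pochhammer_inf (fps_X ^ m) (fps_X ^ m)"
    using q_Pochhammer_inf_fps(1)[OF assms, where 'a = rat] by simp
  show "(\<lambda>n. fps_of_int_fps (euler_upto m n)) \<longlonglongrightarrow> fps_of_int_fps (euler m)"
    using tendsto_euler[OF assms] unfolding tendsto_fps_iff
    by (auto simp: fps_of_int_fps_def elim: eventually_mono)
qed

text \<open>Clearing the denominator gives an identity over the integers; it is proved over the
  rationals, where the generating function is a quotient, and pulled back along the injective
  embedding.\<close>

lemma a_colored_mult_euler:
  assumes "k \<ge> 1"
  shows "Abs_fps (\<lambda>n. int (a_colored k n)) * euler 1 ^ k = euler 2 ^ (k - 1)"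
proof (rule fps_of_int_fps_inject)
  have A: "fps_of_int_fps (Abs_fps (\<lambda>n. int (a_colored k n))) = Abs_fps (\<lambda>n. of_nat (a_colored k n))"
    by (simp add: fps_of_int_fps_def)
  have 1: "fps_of_int_fps (euler 1) = q_Pochhammer_inf fps_X fps_X"
    using fps_of_int_fps_euler[of 1] by simp
  have 2: "fps_of_int_fps (euler 2) = q_Pochhammer_inf (fps_X ^ 2) (fps_X ^ 2)"
    by (rule fps_of_int_fps_euler) simp
  \<comment> \<open>Constant term 1 makes the denominator a unit, so the quotient can be multiplied
    out.\<close>
  have "fps_nth (fps_of_int_fps (euler 1) ^ k) 0 = 1"
    by (simp add: fps_of_int_fps_def euler_nth_0 fps_nth_power_0)
  then show "fps_of_int_fps (Abs_fps (\<lambda>n. int (a_colored k n)) * euler 1 ^ k) = fps_of_int_fps (euler 2 ^ (k - 1))"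
    unfolding fps_of_int_fps_mult fps_of_int_fps_power A
      a_colored_generating_function[OF assms] 1 2
    by (simp add: fps_divide_unit mult.assoc inverse_mult_eq_1)
qed

text \<open>Multiplying by \<open>euler 1 ^ 7\<close> turns the quotient into a product of powers,
  as k <= 7; \<open>seven_dvd_nth_cancel\<close> removes the factor again.\<close>

lemma seven_dvd_a_colored:
  assumes "1 \<le> k" "k \<le> 7" "r < 7"
    and "\<And>n. 7 dvd fps_nth (euler 1 ^ (7 - k) * euler 2 ^ (k - 1)) (7 * n + r)"
  shows "[a_colored k (7 * n + r) = 0] (mod 7)"
proof -
  define A where "A = Abs_fps (\<lambda>n. int (a_colored k n))"
  have "A * euler 1 ^ 7 = (A * euler 1 ^ k) * euler 1 ^ (7 - k)"
    using assms(2) by (simp add: mult.assoc power_add [symmetric])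
  also have "\<dots> = euler 1 ^ (7 - k) * euler 2 ^ (k - 1)"
    using a_colored_mult_euler[OF assms(1)] by (simp add: A_def mult.commute)
  finally have "7 dvd fps_nth (A * euler 1 ^ 7) (7 * n + r)" for n
    using assms(4) by simp
  from seven_dvd_nth_cancel[OF assms(3) euler_nth_0 this, of n]
  have "int 7 dvd int (a_colored k (7 * n + r))" by (simp add: A_def)
  then show ?thesis unfolding int_dvd_int_iff cong_0_iff .
qed

theorem theorem3:
  fixes n :: nat
  shows "[a_colored 1 (7 * n + 5) = 0] (mod 7) \<and>
         [a_colored 3 (7 * n + 2) = 0] (mod 7) \<and>
         [a_colored 4 (7 * n + 4) = 0] (mod 7) \<and>
         [a_colored 5 (7 * n + 6) = 0] (mod 7) \<and>
         [a_colored 7 (7 * n + 3) = 0] (mod 7)"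
  by (intro conjI seven_dvd_a_colored)
     (use seven_dvd_euler_1_6 seven_dvd_euler_1_4_2_2 seven_dvd_euler_1_3_2_3
        seven_dvd_euler_1_2_2_4 seven_dvd_euler_2_6 in simp_all)

end
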